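(* Let $a,b,n,s$ be positive integers with $s\ge n+1$ and $b(s-n)+1\le a\le sb$, and put $c_0=s-\lfloor\frac{a-1}{b}\rfloor$ and $\mu_a^0=a-b(s-c_0)$. Let $\mathcal{F}=\{f_1,\dots,f_s\}$ be a generic set of forms sharing a common degree $d$ in $R=\mathbb{K}[x_0,\dots,x_n]$. Then for the ideal $I=I_a(\mathcal{F}^b)$, $$\rho_*(I)=\frac{\alpha(I)}{\widehat{\alpha}_*(I)}=\frac{ac_0}{\mu_a^0 s}.$$
   Context: $\mathbb{K}$ is an infinite field; $R$ is standard graded; a form is a homogeneous polynomial of positive degree. A set of forms in $R$ is generic if every subset of size at most $n+1$ forms an $R$-regular sequence. $I_a(\mathcal{F}^b)=\langle f_1^{n_1}\cdots f_s^{n_s}: 0\le n_i\le b,\ \sum_i n_i=a\rangle$. For a nonzero homogeneous ideal $I$ of $R$ and $m\ge1$: $I^{(m)_*}=\bigcap_{\mathfrak{p}\in\operatorname{Min}(I)}(I^mR_{\mathfrak{p}}\cap R)$ (intersection over the minimal primes of $I$); $\alpha(I)$ is the least degree of a nonzero form in $I$; $\widehat{\alpha}_*(I)=\lim_{m\to\infty}\alpha(I^{(m)_*})/m$; and $\rho_*(I)=\sup\{m/r: I^{(m)_*}\nsubseteq I^r\}$ ($m,r$ positive integers). *)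

theory Defs
  imports
    Complex_Main
    "HOL-Library.Cardinality"
    "HOL-Library.Poly_Mapping"
    "HOL-Library.Extended_Real"
    "HOL-Computational_Algebra.Fraction_Field"
    "HOL-Algebra.Ideal_Product"
    "HOL-Algebra.Algebraic_Closure_Type"
begin

text \<open>
  Polynomials with coefficients in \<open>'k\<close> in the finitely many variables indexed by \<open>'v\<close>: a
  polynomial maps exponent vectors to coefficients.  A linear order on \<open>'v\<close> is required only
  because the library derives the integral domain instance of this type from it.
\<close>

type_synonym ('v, 'k) mpolyn = "('v \<Rightarrow>\<^sub>0 nat) \<Rightarrow>\<^sub>0 'k"

definition homogeneous_of_degree ::
    "nat \<Rightarrow> ('v::{finite,linorder}, 'k::field) mpolyn \<Rightarrow> bool" where
  "homogeneous_of_degree d p \<longleftrightarrow>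
     (\<forall>e \<in> Poly_Mapping.keys p. (\<Sum>v\<in>UNIV. Poly_Mapping.lookup e v) = d)"

definition form_of_degree ::
    "nat \<Rightarrow> ('v::{finite,linorder}, 'k::field) mpolyn \<Rightarrow> bool" where
  "form_of_degree d p \<longleftrightarrow> d > 0 \<and> homogeneous_of_degree d p"

abbreviation ideal_gen :: "'a::comm_ring_1 set \<Rightarrow> 'a set" where
  "ideal_gen S \<equiv> genideal ring_of_type_algebra S"

abbreviation ideal_power :: "'a::comm_ring_1 set \<Rightarrow> nat \<Rightarrow> 'a set" where
  "ideal_power I r \<equiv> I [^]\<^bsub>ideals_set ring_of_type_algebra\<^esub> r"

text \<open>
  The first conjunct says that each entry is a non-zerodivisor modulo the ideal generated by the
  entries before it.
\<close>

definition regular_sequence :: "'a::comm_ring_1 list \<Rightarrow> bool" where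
  "regular_sequence xs \<longleftrightarrow>
     (\<forall>i < length xs. \<forall>g. xs ! i * g \<in> ideal_gen (set (take i xs))
        \<longrightarrow> g \<in> ideal_gen (set (take i xs))) \<and>
     ideal_gen (set xs) \<noteq> UNIV"

text \<open>
  A finite set forms a regular sequence if its elements, listed without repetition in some order,
  do.  For forms of positive degree the order is immaterial.  The bound \<open>CARD('v)\<close> is the number of
  variables, i.e. \<open>n + 1\<close> for variables \<open>x\<^sub>0, \<dots>, x\<^sub>n\<close>.
\<close>

definition forms_regular_sequence :: "'a::comm_ring_1 set \<Rightarrow> bool" where
  "forms_regular_sequence G \<longleftrightarrow> (\<exists>xs. distinct xs \<and> set xs = G \<and> regular_sequence xs)"

definition generic_forms :: "('v::{finite,linorder}, 'k::field) mpolyn set \<Rightarrow> bool" where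
  "generic_forms F \<longleftrightarrow>
     (\<forall>p \<in> F. \<exists>d. form_of_degree d p) \<and>
     (\<forall>G \<subseteq> F. finite G \<and> card G \<le> CARD('v) \<longrightarrow> forms_regular_sequence G)"

text \<open>The ideal \<open>I\<^sub>a(F\<^sup>b)\<close> for \<open>F = {f 1, \<dots>, f s}\<close>.\<close>

definition fold_power_ideal :: "nat \<Rightarrow> nat \<Rightarrow> nat \<Rightarrow> (nat \<Rightarrow> 'a::comm_ring_1) \<Rightarrow> 'a set" where
  "fold_power_ideal a b s f =
     ideal_gen {\<Prod>i=1..s. f i ^ e i | e :: nat \<Rightarrow> nat.
                  (\<forall>i\<in>{1..s}. e i \<le> b) \<and> (\<Sum>i=1..s. e i) = a}"

definition minimal_primes :: "'a::comm_ring_1 set \<Rightarrow> 'a set set" where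
  "minimal_primes I =
     {p. primeideal p ring_of_type_algebra \<and> I \<subseteq> p \<and>
         (\<forall>q. primeideal q ring_of_type_algebra \<and> I \<subseteq> q \<and> q \<subseteq> p \<longrightarrow> q = p)}"

text \<open>The localization of a domain at a prime ideal, as a subring of the field of fractions.\<close>

definition localization_at :: "'a::idom set \<Rightarrow> 'a fract ring" where
  "localization_at p =
     ring_of_type_algebra\<lparr>carrier := {Fraction_Field.Fract g u | g u. u \<notin> p}\<rparr>"

text \<open>The contraction \<open>J R\<^sub>p \<inter> R\<close> of the extended ideal.\<close>

definition local_contraction :: "'a::idom set \<Rightarrow> 'a set \<Rightarrow> 'a set" where
  "local_contraction p J =
     {g. Fraction_Field.Fract g 1
           \<in> genideal (localization_at p) ((\<lambda>h. Fraction_Field.Fract h 1) ` J)}"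

definition symbolic_power :: "'a::idom set \<Rightarrow> nat \<Rightarrow> 'a set" where
  "symbolic_power I m = (\<Inter>p \<in> minimal_primes I. local_contraction p (ideal_power I m))"

definition initial_degree :: "('v::{finite,linorder}, 'k::field) mpolyn set \<Rightarrow> nat" where
  "initial_degree I = (LEAST d. \<exists>p \<in> I. p \<noteq> 0 \<and> form_of_degree d p)"

definition asymptotic_initial_degree ::
    "('v::{finite,linorder}, 'k::field) mpolyn set \<Rightarrow> real" where
  "asymptotic_initial_degree I =
     lim (\<lambda>m. real (initial_degree (symbolic_power I m)) / real m)"

definition resurgence :: "'a::idom set \<Rightarrow> ereal" where
  "resurgence I =
     Sup {ereal (real m / real r) | m r.
            m > 0 \<and> r > 0 \<and> \<not> symbolic_power I m \<subseteq> ideal_power I r}"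

end

(*
  Write c for c_0. The minimal primes of I are those over the complete intersections
  (f_i : i in T), |T| = c, and I coincides locally with (f_i : i in T)^\<mu>. A prime that is maximal
  among the ideals avoiding the nonzerodivisors modulo (f_i : i in T)^k is minimal over I, because
  n + 2 polynomials in n + 1 variables are algebraically dependent; hence I^(m)_* lies in
  (f_i : i in T)^(\<mu> m) for every T. The intersection of these powers over all T is generated by
  monomials in the f_i: modulo a suitable f_i one passes to c - 1, and otherwise f_i can be
  divided out. An averaging argument on exponents then gives I^(m)_* \<subseteq> I^r whenever
  r a c \<le> \<mu> m s. Conversely (f_1 ... f_s)^j lies in I^(m)_* once \<mu> m \<le> c j, and comparing degrees
  shows that both bounds are sharp.
*)

theory Submission
  imports Defs
begin

section \<open>Ideals of a commutative ring type\<close>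

text \<open>Unmixedness of the powers of a complete intersection, usually a matter of primary
  decomposition, is replaced by two elementary facts about the mixed ideals (f_i : i \<in> U) + (f_i
  : i \<in> T)^j: their colon ideals by a single f_i are explicit, and a nonzero polynomial with
  constant coefficients in at most n + 1 - |U| - |T| further f_i is a nonzerodivisor modulo them.
  Mixed ideals are forced because setting f_t to zero moves t from T to U. In the intersection over
  all T, dividing out f_i lowers the required power only for those T that contain i. The induction
  therefore has to admit powers that depend on T, recorded by weights on the indices. The constant
  comes from the exponents: those with sum at least \<mu> m on every c-subset have total at least
  \<mu> m s / c, attained by equal entries, while I^r starts at total r a. Entries above r b do not
  help membership in I^r, so the averaging has to be done with capped exponents.\<close>

interpretation ideals: Modules.module "(*) :: 'a::comm_ring_1 \<Rightarrow> 'a \<Rightarrow> 'a"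
  by unfold_locales (auto simp: algebra_simps)

text \<open>As a rewrite rule this would loop together with associativity.\<close>
declare ideals.scale_scale [simp del]

section \<open>Ideals, primes and ideal powers as submodules of the ring\<close>

lemma carrier_ring_of_type_algebra [simp]: "carrier ring_of_type_algebra = UNIV"
  and mult_ring_of_type_algebra [simp]: "x \<otimes>\<^bsub>ring_of_type_algebra\<^esub> y = x * y"
  and add_ring_of_type_algebra [simp]: "x \<oplus>\<^bsub>ring_of_type_algebra\<^esub> y = x + y"
  and zero_ring_of_type_algebra [simp]: "\<zero>\<^bsub>ring_of_type_algebra\<^esub> = 0"
  and one_ring_of_type_algebra [simp]: "\<one>\<^bsub>ring_of_type_algebra\<^esub> = 1"
  by (simp_all add: ring_of_type_algebra_def)

lemma a_inv_ring_of_type_algebra [simp]: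
  "\<ominus>\<^bsub>ring_of_type_algebra\<^esub> x = - (x :: 'a::comm_ring_1)"
proof -
  interpret R: ring "ring_of_type_algebra :: 'a ring" by (rule ring_from_type_algebra)
  show ?thesis
    by (rule R.minus_equality) simp_all
qed

lemma ideal_iff_subspace:
  "ideal J (ring_of_type_algebra :: 'a::comm_ring_1 ring) \<longleftrightarrow> ideals.subspace J"
proof
  assume "ideal J (ring_of_type_algebra :: 'a ring)"
  then interpret ideal J "ring_of_type_algebra :: 'a ring" .
  show "ideals.subspace J"
    unfolding ideals.subspace_def
    using additive_subgroup.zero_closed[OF is_additive_subgroup]
      additive_subgroup.a_closed[OF is_additive_subgroup] I_l_closed by simp
next
  interpret R: ring "ring_of_type_algebra :: 'a ring" by (rule ring_from_type_algebra)
  assume J: "ideals.subspace J"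
  show "ideal J (ring_of_type_algebra :: 'a ring)"
  proof (rule idealI)
    show "ring (ring_of_type_algebra :: 'a ring)" by (rule ring_from_type_algebra)
    show "subgroup J (add_monoid (ring_of_type_algebra :: 'a ring))"
      using J by (intro R.add.subgroupI)
        (auto intro: ideals.subspace_add ideals.subspace_0 simp: ideals.subspace_neg
          simp flip: a_inv_def)
  next
    fix a x assume "a \<in> J"
    then have "x * a \<in> J" using J by (rule ideals.subspace_scale[rotated])
    then show "x \<otimes>\<^bsub>ring_of_type_algebra\<^esub> a \<in> J" "a \<otimes>\<^bsub>ring_of_type_algebra\<^esub> x \<in> J"
      by (simp_all add: mult.commute)
  qed
qed

lemma ideal_gen_eq_span: "ideal_gen S = ideals.span (S :: 'a::comm_ring_1 set)"
  unfolding genideal_def ideal_iff_subspace ideals.span_def hull_def by simp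

lemma primeideal_iff:
  "primeideal p (ring_of_type_algebra :: 'a::comm_ring_1 ring) \<longleftrightarrow>
     ideals.subspace p \<and> 1 \<notin> p \<and> (\<forall>x y. x * y \<in> p \<longrightarrow> x \<in> p \<or> y \<in> p)"
proof -
  have "1 \<notin> p \<longleftrightarrow> UNIV \<noteq> p" if "ideals.subspace p"
    using ideals.subspace_scale[OF that, of 1] by auto
  then show ?thesis
    unfolding primeideal_def primeideal_axioms_def ideal_iff_subspace
    using cring_from_type_algebra by auto
qed

lemma ideal_power_0: "ideal_power (I :: 'a::comm_ring_1 set) 0 = UNIV"
  by (simp add: ideals_set_def nat_pow_def)

lemma ideal_power_Suc:
  "ideal_power (I :: 'a::comm_ring_1 set) (Suc r) =
     ideal_prod ring_of_type_algebra (ideal_power I r) I"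
  by (simp add: ideals_set_def nat_pow_def)

lemma subspace_ideal_prod:
  assumes "ideals.subspace (I :: 'a::comm_ring_1 set)" "ideals.subspace J"
  shows "ideals.subspace (ideal_prod ring_of_type_algebra I J)"
proof -
  interpret R: ring "ring_of_type_algebra :: 'a ring" by (rule ring_from_type_algebra)
  show ?thesis
    using R.ideal_prod_is_ideal[of I J] assms by (simp add: ideal_iff_subspace)
qed

lemma subspace_ideal_power:
  assumes "ideals.subspace (I :: 'a::comm_ring_1 set)"
  shows "ideals.subspace (ideal_power I r)"
  by (induction r) (simp_all only: ideal_power_0 ideal_power_Suc subspace_ideal_prod assms ideals.subspace_UNIV)

lemma ideal_prod_subset:
  assumes "ideals.subspace (K :: 'a::comm_ring_1 set)"
    and "\<And>x y. x \<in> I \<Longrightarrow> y \<in> J \<Longrightarrow> x * y \<in> K"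
  shows "ideal_prod ring_of_type_algebra I J \<subseteq> K"
proof
  fix x assume "x \<in> ideal_prod ring_of_type_algebra I J"
  then show "x \<in> K"
    by induction (auto intro: assms ideals.subspace_add)
qed

lemma span_mult_mem:
  assumes "x \<in> ideals.span (A :: 'a::comm_ring_1 set)" "y \<in> ideals.span B" "ideals.subspace K"
    and "\<And>u v. u \<in> A \<Longrightarrow> v \<in> B \<Longrightarrow> u * v \<in> K"
  shows "x * y \<in> K"
proof -
  have *: "u * y \<in> K" if "u \<in> A" for u
    using assms(2)
  proof (induction rule: ideals.span_induct_alt)
    case base
    show ?case using assms(3) by (simp add: ideals.subspace_0)
  next
    case (step c v w)
    have "u * (c * v + w) = c * (u * v) + u * w" by (simp add: algebra_simps)
    then show ?case
      using step assms(3,4) that by (simp add: ideals.subspace_add ideals.subspace_scale)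
  qed
  show ?thesis using assms(1)
  proof (induction rule: ideals.span_induct_alt)
    case base
    show ?case using assms(3) by (simp add: ideals.subspace_0)
  next
    case (step c v w)
    have "(c * v + w) * y = c * (v * y) + w * y" by (simp add: algebra_simps)
    then show ?case
      using step assms(3) * by (simp add: ideals.subspace_add ideals.subspace_scale)
  qed
qed

text \<open>The fractions with numerator in \<open>J\<close> and denominator outside
  \<open>p\<close> already form an ideal of the localization, and comparing one of them with g/1 in
  a domain clears the denominator. Symbolic powers can then be handled without fractions.\<close>

lemma local_contraction_eq:
  assumes p: "primeideal (p :: 'a::idom set) ring_of_type_algebra" and J: "ideals.subspace J"
  shows "local_contraction p J = {g. \<exists>u. u \<notin> p \<and> u * g \<in> J}"
proof -
  let ?K = "ring_of_type_algebra :: 'a fract ring"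
  let ?L = "localization_at p"
  define C where "C = {Fraction_Field.Fract g u | g u. u \<notin> p}"
  have pI: "ideals.subspace p" "1 \<notin> p" and pr: "\<And>x y. x * y \<in> p \<Longrightarrow> x \<in> p \<or> y \<in> p"
    using p by (auto simp: primeideal_iff)
  have nz: "u \<noteq> 0" if "u \<notin> p" for u
    using that ideals.subspace_0[OF pI(1)] by auto
  have mulp: "u * v \<notin> p" if "u \<notin> p" "v \<notin> p" for u v
    using pr that by blast
  have L: "?L = ?K\<lparr>carrier := C\<rparr>" by (simp add: localization_at_def C_def)
  interpret K: ring ?K by (rule ring_from_type_algebra)
  have "subring C ?K"
  proof (rule K.subringI)
    show "\<one>\<^bsub>?K\<^esub> \<in> C" unfolding C_def using pI by (auto simp: One_fract_def)
  next
    fix h assume "h \<in> C"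
    then obtain g u where "h = Fraction_Field.Fract g u" "u \<notin> p" unfolding C_def by auto
    then have "- h = Fraction_Field.Fract (- g) u" "u \<notin> p" by simp_all
    then show "\<ominus>\<^bsub>?K\<^esub> h \<in> C" unfolding C_def by auto
  next
    fix h1 h2 assume "h1 \<in> C" "h2 \<in> C"
    then obtain g1 u1 g2 u2 where *: "h1 = Fraction_Field.Fract g1 u1" "u1 \<notin> p"
      "h2 = Fraction_Field.Fract g2 u2" "u2 \<notin> p" unfolding C_def by auto
    have "h1 * h2 = Fraction_Field.Fract (g1 * g2) (u1 * u2)" using * by simp
    then show "h1 \<otimes>\<^bsub>?K\<^esub> h2 \<in> C" using mulp[OF *(2,4)] unfolding C_def by auto
    have "h1 + h2 = Fraction_Field.Fract (g1 * u2 + g2 * u1) (u1 * u2)" using * nz by simp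
    then show "h1 \<oplus>\<^bsub>?K\<^esub> h2 \<in> C" using mulp[OF *(2,4)] unfolding C_def by auto
  qed simp
  then have rL: "ring ?L" unfolding L by (rule K.subring_is_ring)
  then interpret L: ring ?L .
  let ?S = "(\<lambda>h. Fraction_Field.Fract h 1) ` J"
  have SC: "?S \<subseteq> carrier ?L" unfolding L using pI by (auto simp: C_def)
  define Q where "Q = {Fraction_Field.Fract h u | h u. h \<in> J \<and> u \<notin> p}"
  have mQ: "x * y \<in> Q" if xQ: "x \<in> Q" and yC: "y \<in> C" for x y
  proof -
    obtain h u where h: "x = Fraction_Field.Fract h u" "h \<in> J" "u \<notin> p"
      using xQ unfolding Q_def by auto
    obtain g v where g: "y = Fraction_Field.Fract g v" "v \<notin> p"
      using yC unfolding C_def by auto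
    have "x * y = Fraction_Field.Fract (g * h) (u * v)"
      using h g by (simp add: mult.commute)
    moreover have "g * h \<in> J" using h J by (auto intro: ideals.subspace_scale)
    ultimately show ?thesis unfolding Q_def using mulp[OF h(3) g(2)] by blast
  qed
  have "ideal Q ?L"
  proof (rule idealI[OF rL])
    show "subgroup Q (add_monoid ?L)"
    proof (rule L.add.subgroupI)
      show "Q \<subseteq> carrier ?L" unfolding L Q_def C_def by auto
      show "Q \<noteq> {}" unfolding Q_def using ideals.subspace_0[OF J] pI by blast
    next
      fix x assume x: "x \<in> Q"
      then obtain h u where hu: "x = Fraction_Field.Fract h u" "h \<in> J" "u \<notin> p"
        unfolding Q_def by auto
      have m: "- x = Fraction_Field.Fract (- h) u" using hu by simp
      have xC: "x \<in> C" "- x \<in> C" using hu(1,3) m unfolding C_def by blast+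
      have "\<ominus>\<^bsub>?L\<^esub> x = - x"
      proof (rule L.minus_equality)
        show "- x \<in> carrier ?L"
          using xC unfolding L by simp
        show "x \<in> carrier ?L"
          using xC unfolding L by simp
      qed (simp add: L)
      moreover have "- x \<in> Q"
        using m hu(3) ideals.subspace_neg[OF J hu(2)] unfolding Q_def by blast
      ultimately show "\<ominus>\<^bsub>?L\<^esub> x \<in> Q" by simp
    next
      fix x y assume "x \<in> Q" "y \<in> Q"
      then obtain g1 u1 g2 u2 where *: "x = Fraction_Field.Fract g1 u1" "u1 \<notin> p"
        "y = Fraction_Field.Fract g2 u2" "u2 \<notin> p" "g1 \<in> J" "g2 \<in> J" unfolding Q_def by auto
      have "x + y = Fraction_Field.Fract (u2 * g1 + u1 * g2) (u1 * u2)"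
        using * nz by (simp add: mult.commute)
      moreover have "u2 * g1 + u1 * g2 \<in> J"
        using * J by (intro ideals.subspace_add ideals.subspace_scale)
      ultimately have "x + y \<in> Q" unfolding Q_def using mulp[OF *(2,4)] by blast
      then show "x \<oplus>\<^bsub>?L\<^esub> y \<in> Q" by (simp add: L)
    qed
  qed (auto simp: L mQ mult.commute)
  moreover have "?S \<subseteq> Q" unfolding Q_def using pI by blast
  ultimately have sub: "genideal ?L ?S \<subseteq> Q" by (rule L.genideal_minimal)
  show ?thesis
  proof (rule Set.set_eqI, rule iffI)
    fix g assume "g \<in> local_contraction p J"
    then have "Fraction_Field.Fract g 1 \<in> Q" using sub unfolding local_contraction_def by auto
    then obtain h u where "Fraction_Field.Fract g 1 = Fraction_Field.Fract h u" "h \<in> J" "u \<notin> p"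
      unfolding Q_def by auto
    then have "u * g = h" "u \<notin> p" "h \<in> J" using nz by (auto simp: eq_fract mult.commute)
    then show "g \<in> {g. \<exists>u. u \<notin> p \<and> u * g \<in> J}" by auto
  next
    fix g assume "g \<in> {g. \<exists>u. u \<notin> p \<and> u * g \<in> J}"
    then obtain u where u: "u \<notin> p" "u * g \<in> J" by auto
    interpret I: ideal "genideal ?L ?S" ?L by (rule L.genideal_ideal[OF SC])
    have "Fraction_Field.Fract (u * g) 1 \<in> genideal ?L ?S"
      using L.genideal_self[OF SC] u by auto
    moreover have "Fraction_Field.Fract 1 u \<in> carrier ?L"
      unfolding L C_def using u by auto
    ultimately have "Fraction_Field.Fract 1 u \<otimes>\<^bsub>?L\<^esub> Fraction_Field.Fract (u * g) 1 \<in> genideal ?L ?S"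
      by (rule I.I_l_closed)
    moreover have "Fraction_Field.Fract 1 u \<otimes>\<^bsub>?L\<^esub> Fraction_Field.Fract (u * g) 1 = Fraction_Field.Fract g 1"
      using nz[OF u(1)] by (simp add: L eq_fract)
    ultimately show "g \<in> local_contraction p J" unfolding local_contraction_def by simp
  qed
qed

text \<open>Krull's argument: an ideal maximal among those over \<open>J\<close> that avoid
  \<open>S\<close> is prime. Adjoining x or y outside it produces an element of \<open>S\<close>
  each time, and the product of these two would lie in the ideal if x * y did.\<close>

lemma exists_prime_disjoint:
  assumes J: "ideals.subspace (J :: 'a::comm_ring_1 set)" and "J \<inter> S = {}" "1 \<in> S"
    and S: "\<And>x y. x \<in> S \<Longrightarrow> y \<in> S \<Longrightarrow> x * y \<in> S"
  obtains p where "primeideal p ring_of_type_algebra" "J \<subseteq> p" "p \<inter> S = {}"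
proof -
  define A where "A = {p. ideals.subspace p \<and> J \<subseteq> p \<and> p \<inter> S = {}}"
  have "\<exists>q\<in>A. \<forall>Q\<in>A. q \<subseteq> Q \<longrightarrow> Q = q"
  proof (rule subset_Zorn_nonempty)
    show "A \<noteq> {}" using assms unfolding A_def by auto
  next
    fix C assume C: "C \<noteq> {}" "subset.chain A C"
    have ch: "\<And>Q Y. Q \<in> C \<Longrightarrow> Y \<in> C \<Longrightarrow> Q \<subseteq> Y \<or> Y \<subseteq> Q" and CA: "C \<subseteq> A"
      using C(2) by (auto simp: subset_chain_def)
    have "ideals.subspace (\<Union>C)"
    proof (rule ideals.subspaceI)
      show "0 \<in> \<Union>C" using C(1) CA ideals.subspace_0 unfolding A_def by blast
      show "x + y \<in> \<Union>C" if xy: "x \<in> \<Union>C" "y \<in> \<Union>C" for x y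
      proof -
        obtain Q Y where "Q \<in> C" "Y \<in> C" "x \<in> Q" "y \<in> Y" using xy by auto
        then obtain Z where "Z \<in> C" "x \<in> Z" "y \<in> Z" using ch[of Q Y] by auto
        then show ?thesis using CA ideals.subspace_add unfolding A_def by blast
      qed
      show "c * x \<in> \<Union>C" if "x \<in> \<Union>C" for c x
        using that CA ideals.subspace_scale unfolding A_def by blast
    qed
    then show "\<Union>C \<in> A" using C(1) CA unfolding A_def by blast
  qed
  then obtain p where p: "ideals.subspace p" "J \<subseteq> p" "p \<inter> S = {}"
    and max: "\<And>Q. ideals.subspace Q \<Longrightarrow> Q \<inter> S = {} \<Longrightarrow> p \<subseteq> Q \<Longrightarrow> Q = p"
    unfolding A_def by (metis (mono_tags, lifting) mem_Collect_eq order_trans)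
  have ex: "\<exists>k. \<exists>s\<in>S. s - k * x \<in> p" if xp: "x \<notin> p" for x
  proof (rule ccontr)
    assume neg: "\<not> ?thesis"
    have pp: "ideals.span p = p" using p(1) by (simp only: ideals.span_eq_iff)
    have "ideals.span (insert x p) \<inter> S = {}"
      using neg unfolding ideals.span_insert pp by blast
    then have "ideals.span (insert x p) = p"
      using ideals.span_superset[of "insert x p"] by (intro max) auto
    then show False using xp ideals.span_base[of x "insert x p"] by simp
  qed
  have "x \<in> p \<or> y \<in> p" if xy: "x * y \<in> p" for x y
  proof (rule ccontr)
    assume "\<not> ?thesis"
    then have "x \<notin> p" "y \<notin> p" by auto
    then obtain k s l t where *: "s \<in> S" "s - k * x \<in> p" "t \<in> S" "t - l * y \<in> p"
      using ex[of x] ex[of y] by blast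
    have "s * t = s * (t - l * y) + ((l * y) * (s - k * x) + (k * l) * (x * y))"
      by (simp add: algebra_simps)
    also have "\<dots> \<in> p"
      by (rule ideals.subspace_add[OF p(1) ideals.subspace_scale[OF p(1) *(4)]
            ideals.subspace_add[OF p(1) ideals.subspace_scale[OF p(1) *(2)]
              ideals.subspace_scale[OF p(1) xy]]])
    finally show False using S[OF *(1,3)] p(3) by auto
  qed
  moreover have "1 \<notin> p" using assms p by auto
  ultimately show ?thesis using that[of p] p by (auto simp: primeideal_iff)
qed

section \<open>Monomial ideals and colon ideals of regular sequences\<close>

definition monomial :: "'i set \<Rightarrow> ('i \<Rightarrow> 'a) \<Rightarrow> ('i \<Rightarrow> nat) \<Rightarrow> 'a::comm_ring_1" where
  "monomial V h e = (\<Prod>i\<in>V. h i ^ e i)"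

text \<open>Encoding ideals by a condition on exponents turns inclusions into implications between
  exponent sums. \<open>P\<close> may be any condition, not only an upward closed one, so that
  monomials with exponent 0 at a chosen index can be singled out.\<close>

definition monomial_ideal :: "'i set \<Rightarrow> ('i \<Rightarrow> 'a) \<Rightarrow> (('i \<Rightarrow> nat) \<Rightarrow> bool) \<Rightarrow> 'a::comm_ring_1 set" where
  "monomial_ideal V h P = ideals.span {monomial V h e | e. P e}"

lemma monomial_0: "monomial V h (\<lambda>_. 0) = 1"
  by (simp add: monomial_def)

lemma monomial_add: "monomial V h (\<lambda>i. e i + e' i) = monomial V h e * monomial V h e'"
  by (simp add: monomial_def power_add prod.distrib)

lemma monomial_Suc:
  assumes "finite V" "i \<in> V"
  shows "monomial V h (e(i := Suc (e i))) = h i * monomial V h e"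
  using assms unfolding monomial_def
  by (subst (1 2) prod.remove[of V i]) (auto simp: mult.assoc intro!: prod.cong arg_cong2[where f = "(*)"])

lemma subspace_monomial_ideal [simp]: "ideals.subspace (monomial_ideal V h P)"
  by (simp add: monomial_ideal_def)

lemma monomial_in_monomial_ideal: "P e \<Longrightarrow> monomial V h e \<in> monomial_ideal V h P"
  unfolding monomial_ideal_def by (rule ideals.span_base) auto

lemma monomial_ideal_subset:
  assumes "ideals.subspace J" "\<And>e. P e \<Longrightarrow> monomial V h e \<in> J"
  shows "monomial_ideal V h P \<subseteq> J"
  unfolding monomial_ideal_def using assms by (intro ideals.span_minimal) auto

lemma monomial_ideal_mono:
  assumes "\<And>e. P e \<Longrightarrow> Q e" shows "monomial_ideal V h P \<subseteq> monomial_ideal V h Q"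
  using assms by (intro monomial_ideal_subset) (auto intro: monomial_in_monomial_ideal)

lemma monomial_ideal_weaken:
  assumes "x \<in> monomial_ideal V h P" "\<And>e. P e \<Longrightarrow> Q e" shows "x \<in> monomial_ideal V h Q"
  using assms monomial_ideal_mono[of P Q V h] by blast

lemma monomial_ideal_mult_gen:
  assumes "finite V" "i \<in> V" "x \<in> monomial_ideal V h P"
    and "\<And>e. P e \<Longrightarrow> Q (e(i := Suc (e i)))"
  shows "h i * x \<in> monomial_ideal V h Q"
proof -
  have "h i * x \<in> monomial_ideal V h Q" if "x \<in> ideals.span {monomial V h e | e. P e}"
  proof (rule span_mult_mem[of _ "{h i}", OF _ that])
    fix u v assume "u \<in> {h i}" "v \<in> {monomial V h e | e. P e}"
    then obtain e where "u = h i" "v = monomial V h e" "P e" by auto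
    then show "u * v \<in> monomial_ideal V h Q"
      using assms by (metis monomial_Suc monomial_in_monomial_ideal)
  qed (auto intro: ideals.span_base)
  then show ?thesis using assms(3) by (simp add: monomial_ideal_def)
qed

text \<open>Generators are sorted by whether \<open>h i\<close> occurs in them. This serves as
  reduction modulo \<open>h i\<close>, although the coefficients stay arbitrary ring elements: only
  the monomials in \<open>z\<close> are free of \<open>h i\<close>.\<close>

lemma monomial_ideal_split:
  assumes "finite V" "i \<in> V" "x \<in> monomial_ideal V h P"
  obtains y z where "x = h i * y + z"
    "y \<in> monomial_ideal V h (\<lambda>e. P (e(i := Suc (e i))))"
    "z \<in> monomial_ideal V h (\<lambda>e. P e \<and> e i = 0)"
proof -
  let ?A = "monomial_ideal V h (\<lambda>e. P (e(i := Suc (e i))))"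
  let ?B = "monomial_ideal V h (\<lambda>e. P e \<and> e i = 0)"
  have "\<exists>y\<in>?A. \<exists>z\<in>?B. x = h i * y + z"
    using assms(3) unfolding monomial_ideal_def[of V h P]
  proof (induction rule: ideals.span_induct_alt)
    case base
    show ?case
      by (rule bexI[of _ 0], rule bexI[of _ 0]) (auto intro: ideals.subspace_0)
  next
    case (step c m w)
    then obtain e y z where e: "m = monomial V h e" "P e"
      and w: "y \<in> ?A" "z \<in> ?B" "w = h i * y + z" by blast
    show ?case
    proof (cases "e i")
      case 0
      then have "c * m + z \<in> ?B"
        using e w(2) by (intro ideals.subspace_add ideals.subspace_scale)
          (auto intro: monomial_in_monomial_ideal)
      moreover have "c * m + w = h i * y + (c * m + z)" using w by (simp add: algebra_simps)
      ultimately show ?thesis using w(1) by blast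
    next
      case (Suc k)
      have ek: "e = (e(i := k))(i := Suc ((e(i := k)) i))" using Suc by auto
      then have m: "m = h i * monomial V h (e(i := k))"
        unfolding e(1) using monomial_Suc[OF assms(1,2), of h "e(i := k)"] by simp
      have "P ((e(i := k))(i := Suc ((e(i := k)) i)))" using e(2) ek by simp
      then have "c * monomial V h (e(i := k)) + y \<in> ?A"
        using w(1) by (intro ideals.subspace_add ideals.subspace_scale)
          (auto intro!: monomial_in_monomial_ideal)
      moreover have "c * m + w = h i * (c * monomial V h (e(i := k)) + y) + z"
        unfolding m w(3) by (simp add: algebra_simps)
      ultimately show ?thesis using w(2) by blast
    qed
  qed
  then show ?thesis using that by blast
qed

lemma span_image_eq_monomial_ideal:
  assumes "finite V" "U \<subseteq> V"
  shows "ideals.span (h ` U) = monomial_ideal V h (\<lambda>e. 1 \<le> sum e U)"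
proof (intro antisym ideals.span_minimal monomial_ideal_subset)
  show "h ` U \<subseteq> monomial_ideal V h (\<lambda>e. 1 \<le> sum e U)"
  proof
    fix x assume "x \<in> h ` U"
    then obtain i where i: "i \<in> U" "x = h i" by auto
    have "h i * monomial V h (\<lambda>_. 0) = monomial V h ((\<lambda>_. 0)(i := Suc 0))"
      using monomial_Suc[of V i h "\<lambda>_. 0"] assms i by auto
    then have "x = monomial V h ((\<lambda>_. 0)(i := Suc 0))" using i by (simp add: monomial_0)
    moreover have "1 \<le> sum ((\<lambda>_. 0)(i := Suc 0)) U"
      using i assms finite_subset[of U V] by (simp add: sum.remove[of U i])
    ultimately show "x \<in> monomial_ideal V h (\<lambda>e. 1 \<le> sum e U)"
      by (simp add: monomial_in_monomial_ideal)
  qed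
next
  fix e :: "'a \<Rightarrow> nat" assume "1 \<le> sum e U"
  then obtain i where i: "i \<in> U" "e i \<noteq> 0"
    by (metis not_one_le_zero sum.neutral)
  then have "monomial V h e = h i ^ (e i - 1) * (\<Prod>j\<in>V - {i}. h j ^ e j) * h i"
    using assms unfolding monomial_def
    by (subst prod.remove[of V i]) (auto simp: power_eq_if[of _ "e i"] mult_ac)
  then show "monomial V h e \<in> ideals.span (h ` U)"
    using i by (auto intro: ideals.span_scale ideals.span_base)
qed simp_all

text \<open>Every subfamily of at most \<open>N\<close> members is regular in every order, while
  \<open>V0\<close> itself may be larger than \<open>N\<close>. The order must be free because the
  arguments below choose which f_i to set to zero.\<close>

locale permutable_regular =
  fixes V0 :: "'i set" and f :: "'i \<Rightarrow> 'a::comm_ring_1" and N :: nat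
  assumes fin: "finite V0"
    and reg: "\<And>U i x. U \<subseteq> V0 \<Longrightarrow> card U < N \<Longrightarrow> i \<in> V0 \<Longrightarrow> i \<notin> U \<Longrightarrow>
      f i * x \<in> ideals.span (f ` U) \<Longrightarrow> x \<in> ideals.span (f ` U)"
begin

abbreviation mon :: "('i \<Rightarrow> nat) \<Rightarrow> 'a" where "mon \<equiv> monomial V0 f"
abbreviation MI :: "(('i \<Rightarrow> nat) \<Rightarrow> bool) \<Rightarrow> 'a set" where "MI \<equiv> monomial_ideal V0 f"

text \<open>The ideal \<open>(f\<^sub>i : i \<in> U) + (f\<^sub>i : i \<in> T)\<^sup>j\<close>.\<close>

definition L :: "'i set \<Rightarrow> 'i set \<Rightarrow> nat \<Rightarrow> 'a set" where
  "L U T j = MI (\<lambda>e. 1 \<le> sum e U \<or> j \<le> sum e T)"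

lemma subspace_L [simp]: "ideals.subspace (L U T j)"
  by (simp add: L_def)

lemma L_0: "L U T 0 = UNIV"
proof -
  have "1 \<in> L U T 0" unfolding L_def
    using monomial_in_monomial_ideal[of _ "\<lambda>_. 0" V0 f] by (simp add: monomial_0)
  then show ?thesis using ideals.subspace_scale[OF subspace_L, of 1] by auto
qed

lemma L_empty: "U \<subseteq> V0 \<Longrightarrow> L U {} (Suc j) = ideals.span (f ` U)"
  using fin by (simp add: L_def span_image_eq_monomial_ideal)

lemma finite_sub: "T \<subseteq> V0 \<Longrightarrow> finite T"
  using fin finite_subset by blast

lemma L_anti: "j \<le> k \<Longrightarrow> L U T k \<subseteq> L U T j"
  unfolding L_def by (rule monomial_ideal_mono) auto

lemma sum_Suc_upd: "finite T \<Longrightarrow> sum (e(i := Suc (e i))) T = sum e T + (if i \<in> T then 1 else 0)"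
  for e :: "'i \<Rightarrow> nat"
  by (cases "i \<in> T") (auto simp: sum.remove[of T i] intro!: sum.cong)

text \<open>After splitting, \<open>z\<close> has no factor \<open>f i\<close> in its monomials, so
  it meets the power condition on \<open>T - {i}\<close> alone; cancelling \<open>f i\<close> from
  f_i (x - y) is then a colon by an element outside \<open>T - {i}\<close>. That case is kept as a
  hypothesis so that the lemma serves both inside the induction for \<open>colon_notin\<close> and
  after it.\<close>

lemma colon_mem_of_notin:
  assumes not: "\<And>x. f i * x \<in> L U (T - {i}) j \<Longrightarrow> x \<in> L U (T - {i}) j"
    and T: "i \<in> T" "T \<subseteq> V0" "U \<subseteq> V0" "i \<notin> U" and x: "f i * x \<in> L U T j"
  shows "x \<in> L U T (j - 1)"
proof -
  have finT: "finite T" "finite U" using T finite_sub by auto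
  obtain y z where yz: "f i * x = f i * y + z"
    "y \<in> MI (\<lambda>e. 1 \<le> sum (e(i := Suc (e i))) U \<or> j \<le> sum (e(i := Suc (e i))) T)"
    "z \<in> MI (\<lambda>e. (1 \<le> sum e U \<or> j \<le> sum e T) \<and> e i = 0)"
    by (rule monomial_ideal_split[OF fin subsetD[OF T(2,1)] x[unfolded L_def]])
  have "y \<in> L U T (j - 1)"
    unfolding L_def using yz(2)
    by (rule monomial_ideal_weaken) (use T finT in \<open>auto simp: sum_Suc_upd simp del: fun_upd_apply\<close>)
  moreover have "z \<in> L U (T - {i}) j"
    unfolding L_def using yz(3)
    by (rule monomial_ideal_weaken) (use T finT in \<open>auto simp: sum.remove[of T i]\<close>)
  then have "f i * (x - y) \<in> L U (T - {i}) j" using yz(1) by (simp add: algebra_simps)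
  then have "x - y \<in> L U (T - {i}) j" by (rule not)
  then have "x - y \<in> L U T (j - 1)"
    unfolding L_def
    by (rule monomial_ideal_weaken) (use T finT in \<open>auto simp: sum.remove[of T i]\<close>)
  ultimately have "(x - y) + y \<in> L U T (j - 1)" by (intro ideals.subspace_add) auto
  then show ?thesis by simp
qed

text \<open>Induction on \<open>T\<close>, then on \<open>j\<close>. Modulo f_t the index t moves
  from T to U, which leaves |U| + |T| unchanged, so the claim for the smaller T gives x = f_t y + z
  with z already in the ideal. It remains to see that y lies in the ideal with j lowered by
  one.\<close>

lemma colon_notin:
  assumes "U \<subseteq> V0" "T \<subseteq> V0" "U \<inter> T = {}" "i \<in> V0" "i \<notin> U" "i \<notin> T" "card U + card T < N"
    and "f i * x \<in> L U T j"
  shows "x \<in> L U T j"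
  using finite_sub[OF assms(2)] assms
proof (induction T arbitrary: U i x j rule: finite_induct)
  case empty
  show ?case
  proof (cases j)
    case 0
    then show ?thesis by (simp add: L_0)
  next
    case (Suc k)
    then show ?thesis
      using empty.prems reg[of U i x] by (simp add: L_empty)
  qed
next
  case (insert t T U i x j)
  have U: "finite U" using insert.prems(1) by (rule finite_sub)
  have i: "i \<noteq> t" using insert.prems by auto
  from insert.prems show ?case
  proof (induction j arbitrary: x)
    case 0
    then show ?case by (simp add: L_0)
  next
    case (Suc j)
    have sub1: "L U (insert t T) k \<subseteq> L (insert t U) T k" for k
      unfolding L_def using U insert.hyps Suc.prems by (intro monomial_ideal_mono) auto
    have sub2: "L U T k \<subseteq> L U (insert t T) k" for k
      unfolding L_def using insert.hyps by (intro monomial_ideal_mono) auto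
    have tV: "t \<in> V0" using Suc.prems(2) by auto
    have xL: "x \<in> L (insert t U) T (Suc j)"
    proof (rule insert.IH[of "insert t U" i])
      show "insert t U \<subseteq> V0" "T \<subseteq> V0" using Suc.prems(1,2) by auto
      show "insert t U \<inter> T = {}" "i \<in> V0" "i \<notin> insert t U" "i \<notin> T"
        using Suc.prems(3-6) insert.hyps by auto
      have "t \<notin> U" using Suc.prems(3) by auto
      then show "card (insert t U) + card T < N" using Suc.prems(7) U insert.hyps by simp
      show "f i * x \<in> L (insert t U) T (Suc j)" using Suc.prems(8) sub1 by blast
    qed
    obtain y z where yz: "x = f t * y + z"
      "z \<in> MI (\<lambda>e. (1 \<le> sum e (insert t U) \<or> Suc j \<le> sum e T) \<and> e t = 0)"
      by (rule monomial_ideal_split[OF fin tV xL[unfolded L_def]])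
    have "z \<in> L U T (Suc j)"
      unfolding L_def using yz(2)
      by (rule monomial_ideal_weaken) (use U Suc.prems(3) in \<open>auto split: if_splits\<close>)
    then have z: "z \<in> L U (insert t T) (Suc j)" using sub2 by auto
    \<comment> \<open>Cancelling f_t costs one power, which the inner induction on j absorbs;
      multiplying y by f_t at the end restores it.\<close>
    have "f t * (f i * y) = f i * x - f i * z" using yz(1) by (simp add: algebra_simps)
    also have "\<dots> \<in> L U (insert t T) (Suc j)"
      using z Suc.prems(8) by (metis ideals.subspace_diff ideals.subspace_scale subspace_L)
    finally have "f i * y \<in> L U (insert t T) (Suc j - 1)"
    proof (rule colon_mem_of_notin[rotated -1])
      fix v assume "f t * v \<in> L U (insert t T - {t}) (Suc j)"
      moreover have "insert t T - {t} = T" using insert.hyps by auto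
      moreover have "t \<notin> U" "t \<in> V0" "T \<subseteq> V0" "U \<inter> T = {}" "card U + card T < N"
        using Suc.prems(2,3,7) insert.hyps by auto
      ultimately show "v \<in> L U (insert t T - {t}) (Suc j)"
        using insert.IH[of U t v "Suc j"] Suc.prems(1) insert.hyps(2) by argo
    next
      show "t \<in> insert t T" "insert t T \<subseteq> V0" "U \<subseteq> V0" "t \<notin> U"
        using Suc.prems(1-3) by auto
    qed
    then have "y \<in> L U (insert t T) j"
      using Suc.IH[of y] Suc.prems by simp
    then have y: "y \<in> MI (\<lambda>e. 1 \<le> sum e U \<or> j \<le> sum e (insert t T))"
      by (simp add: L_def)
    have "f t * y \<in> L U (insert t T) (Suc j)"
      unfolding L_def
    proof (rule monomial_ideal_mult_gen[OF fin tV y])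
      fix e :: "'i \<Rightarrow> nat"
      assume "1 \<le> sum e U \<or> j \<le> sum e (insert t T)"
      moreover have "finite (insert t T)" "t \<in> insert t T" using insert.hyps by auto
      ultimately show "1 \<le> sum (e(t := Suc (e t))) U \<or> Suc j \<le> sum (e(t := Suc (e t))) (insert t T)"
        using U by (auto simp only: sum_Suc_upd split: if_splits)
    qed
    then show ?case unfolding yz(1) by (rule ideals.subspace_add[OF subspace_L _ z])
  qed
qed

lemma colon_in:
  assumes "U \<subseteq> V0" "T \<subseteq> V0" "U \<inter> T = {}" "i \<in> T" "card U + card T \<le> N"
    and "f i * x \<in> L U T j"
  shows "x \<in> L U T (j - 1)"
proof (rule colon_mem_of_notin[OF _ assms(4,2,1) _ assms(6)])
  show "i \<notin> U" using assms by auto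
  fix y assume y: "f i * y \<in> L U (T - {i}) j"
  have "card (T - {i}) < card T"
    using assms(2,4) finite_sub by (intro psubset_card_mono) auto
  then show "y \<in> L U (T - {i}) j"
    using assms(1-5) by (intro colon_notin[OF _ _ _ _ _ _ _ y]) auto
qed

end

section \<open>Intersections of powers\<close>

text \<open>\<open>w v\<close> counts how often f_v has been divided out, so a set T still demands
  the power k - w(T). Modulo f_i, with i of least weight, the sets containing i give the statement
  for c - 1, hence g = f_i y + z with z of the required shape. Then y satisfies the hypothesis with
  \<open>w i\<close> raised by one, and the total deficit, the sum of all k - w v, drops.\<close>

lemma (in permutable_regular) Inter_L_subset_monomial_ideal:
  assumes "U \<subseteq> V0" "V \<subseteq> V0" "U \<inter> V = {}" "card U + c < N"
    and "\<And>T. T \<subseteq> V \<Longrightarrow> card T = c \<Longrightarrow> g \<in> L U T (k - sum w T)"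
  shows "g \<in> MI (\<lambda>e. 1 \<le> sum e U \<or> (\<forall>T\<subseteq>V. card T = c \<longrightarrow> k \<le> sum e T + sum w T))"
  using assms
proof (induction c arbitrary: U V w k g)
  case 0
  have "g \<in> L U {} (k - sum w {})" by (rule 0(5)) auto
  then show ?case unfolding L_def
  proof (rule monomial_ideal_weaken)
    fix e :: "'i \<Rightarrow> nat" assume "1 \<le> sum e U \<or> k - sum w {} \<le> sum e {}"
    moreover have "finite T" if "T \<subseteq> V" for T using that 0(2) finite_sub by auto
    ultimately show "1 \<le> sum e U \<or> (\<forall>T\<subseteq>V. card T = 0 \<longrightarrow> k \<le> sum e T + sum w T)" by auto
  qed
next
  case (Suc c)
  note IHc = Suc.IH
  have finV: "finite V" and finU: "finite U" using Suc.prems(1,2) finite_sub by auto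
  from Suc.prems(5) show ?case
  proof (induction "\<Sum>v\<in>V. k - w v" arbitrary: w g rule: less_induct)
    case less
    let ?Q = "\<lambda>e. 1 \<le> sum e U \<or> (\<forall>T\<subseteq>V. card T = Suc c \<longrightarrow> k \<le> sum e T + sum w T)"
    show ?case
    proof (cases "\<forall>T\<subseteq>V. card T = Suc c \<longrightarrow> k \<le> sum w T")
      case True
      then have "mon (\<lambda>_. 0) \<in> MI ?Q" by (intro monomial_in_monomial_ideal) auto
      then have "g * 1 \<in> MI ?Q"
        unfolding monomial_0 by (rule ideals.subspace_scale[OF subspace_monomial_ideal])
      then show ?thesis by simp
    next
      case False
      then obtain T0 where T0: "T0 \<subseteq> V" "card T0 = Suc c" "sum w T0 < k" by auto
      then obtain v where v: "v \<in> T0" by fastforce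
      have finT0: "finite T0" using T0(1) finV finite_subset by auto
      have "w v \<le> sum w T0" using v finT0 by (intro member_le_sum) auto
      then have wv: "w v < k" "v \<in> V" using T0 v by auto
      \<comment> \<open>An unmet demand forces some weight below k, hence also the least one. This
        makes the deficit drop strictly when \<open>w i\<close> is raised.\<close>
      have "Min (w ` V) \<in> w ` V" using finV wv by (intro Min_in) auto
      then obtain i where i: "i \<in> V" "w i = Min (w ` V)" by auto
      have imin: "w i \<le> w t" if "t \<in> V" for t unfolding i(2) using finV that by auto
      have wi: "w i < k" using imin[OF wv(2)] wv(1) by simp
      have iV0: "i \<in> V0" "i \<notin> U" using i Suc.prems(2,3) by auto
      have "g \<in> MI (\<lambda>e. 1 \<le> sum e (insert i U) \<or>
          (\<forall>T\<subseteq>V - {i}. card T = c \<longrightarrow> k - w i \<le> sum e T + sum w T))"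
      proof (rule IHc)
        show "insert i U \<subseteq> V0" "V - {i} \<subseteq> V0" "insert i U \<inter> (V - {i}) = {}"
          using Suc.prems(1-3) iV0 by auto
        show "card (insert i U) + c < N" using Suc.prems(4) finU iV0 by simp
      next
        fix T assume T: "T \<subseteq> V - {i}" "card T = c"
        then have iT: "i \<notin> T" "finite T" using finV finite_subset[of T V] by auto
        have "g \<in> L U (insert i T) (k - sum w (insert i T))"
          by (rule less.prems) (use T iT i in auto)
        then show "g \<in> L (insert i U) T (k - w i - sum w T)"
          unfolding L_def by (rule monomial_ideal_weaken) (use iT finU iV0 in auto)
      qed
      then obtain y z where yz: "g = f i * y + z"
        "z \<in> MI (\<lambda>e. (1 \<le> sum e (insert i U) \<or>
          (\<forall>T\<subseteq>V - {i}. card T = c \<longrightarrow> k - w i \<le> sum e T + sum w T)) \<and> e i = 0)"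
        by (rule monomial_ideal_split[OF fin iV0(1)])
      have z: "z \<in> MI ?Q" using yz(2)
      proof (rule monomial_ideal_weaken)
        fix e assume e: "(1 \<le> sum e (insert i U) \<or>
          (\<forall>T\<subseteq>V - {i}. card T = c \<longrightarrow> k - w i \<le> sum e T + sum w T)) \<and> e i = 0"
        show "?Q e"
        proof (cases "1 \<le> sum e U")
          case False
          then have e': "k - w i \<le> sum e T + sum w T" if "T \<subseteq> V - {i}" "card T = c" for T
            using e that finU iV0 by auto
          have "k \<le> sum e T + sum w T" if T: "T \<subseteq> V" "card T = Suc c" for T
          proof -
            have finT: "finite T" using T(1) finV finite_subset by auto
            text \<open>Minimality of \<open>w i\<close> allows exchanging \<open>t\<close> for \<open>i\<close> when \<open>i \<notin> T\<close>.\<close>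
            have "T \<noteq> {}" using T(2) by auto
            then obtain t where t: "t \<in> T" "i \<in> T \<longrightarrow> t = i" by blast
            have "k - w i \<le> sum e (T - {t}) + sum w (T - {t})"
              by (rule e') (use T t finT in auto)
            moreover have "w i \<le> w t" using imin t T by auto
            moreover have "sum e T = e t + sum e (T - {t})" "sum w T = w t + sum w (T - {t})"
              using t finT by (auto simp: sum.remove)
            ultimately show ?thesis by simp
          qed
          then show ?thesis by blast
        qed simp
      qed
      let ?w = "w(i := Suc (w i))"
      have y: "y \<in> MI (\<lambda>e. 1 \<le> sum e U \<or> (\<forall>T\<subseteq>V. card T = Suc c \<longrightarrow> k \<le> sum e T + sum ?w T))"
      proof (rule less.hyps)
        have "sum (\<lambda>v. k - ?w v) (V - {i}) = sum (\<lambda>v. k - w v) (V - {i})"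
          by (rule sum.cong) auto
        then show "(\<Sum>v\<in>V. k - ?w v) < (\<Sum>v\<in>V. k - w v)"
          using i(1) finV wi by (simp add: sum.remove[of V i])
      next
        fix T assume T: "T \<subseteq> V" "card T = Suc c"
        have finT: "finite T" using T(1) finV finite_subset by auto
        have TV: "T \<subseteq> V0" "U \<inter> T = {}" "card U + card T < N"
          using T Suc.prems(2-4) by auto
        have "z \<in> L U T (k - sum w T)" unfolding L_def using z
          by (rule monomial_ideal_weaken) (use T in auto)
        then have "g - z \<in> L U T (k - sum w T)"
          by (rule ideals.subspace_diff[OF subspace_L less.prems[OF T]])
        then have fy: "f i * y \<in> L U T (k - sum w T)" using yz(1) by simp
        show "y \<in> L U T (k - sum ?w T)"
        proof (cases "i \<in> T")
          case True
          then have "sum ?w T = Suc (sum w T)" using finT by (simp only: sum_Suc_upd) simp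
          then show ?thesis
            using colon_in[OF Suc.prems(1) TV(1,2) True _ fy] TV(3) by simp
        next
          case False
          then have "sum ?w T = sum w T" using finT by (simp only: sum_Suc_upd) simp
          then show ?thesis
            using colon_notin[OF Suc.prems(1) TV(1,2) iV0 False TV(3) fy] by simp
        qed
      qed
      have "f i * y \<in> MI ?Q"
      proof (rule monomial_ideal_mult_gen[OF fin iV0(1) y])
        fix e :: "'i \<Rightarrow> nat"
        assume e: "1 \<le> sum e U \<or> (\<forall>T\<subseteq>V. card T = Suc c \<longrightarrow> k \<le> sum e T + sum ?w T)"
        have "sum (e(i := Suc (e i))) T + sum w T = sum e T + sum ?w T" if "T \<subseteq> V" for T
          using that finV finite_subset[of T V] by (simp add: sum_Suc_upd del: fun_upd_apply)
        moreover have "sum (e(i := Suc (e i))) U = sum e U"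
          using finU iV0 by (simp only: sum_Suc_upd if_False add_0_right)
        ultimately show "?Q (e(i := Suc (e i)))" using e by metis
      qed
      then show ?thesis unfolding yz(1) by (rule ideals.subspace_add[OF subspace_monomial_ideal _ z])
    qed
  qed
qed

text \<open>In a polynomial expression in \<open>h\<close> that vanishes modulo \<open>J\<close>, cancel the largest power of
  \<open>h i\<close> and then set \<open>h i = 0\<close>.\<close>

lemma reduce_relation:
  assumes W: "finite W" "i \<in> W" and J: "ideals.subspace J"
    and nzd: "\<And>x. h i * x \<in> J \<Longrightarrow> x \<in> J"
    and X: "finite B" "B \<noteq> {}" "\<And>e. e \<in> B \<Longrightarrow> \<forall>j. j \<notin> W \<longrightarrow> e j = 0"
    and c: "\<And>e. e \<in> B \<Longrightarrow> c e \<noteq> (0::'k::zero)"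
    and rel: "(\<Sum>e\<in>B. \<phi> (c e) * monomial W h e) * y \<in> J"
  obtains B' c' where "finite B'" "B' \<noteq> {}" "\<And>e. e \<in> B' \<Longrightarrow> \<forall>j. j \<notin> W - {i} \<longrightarrow> e j = 0"
    "\<And>e. e \<in> B' \<Longrightarrow> c' e \<noteq> 0"
    "(\<Sum>e\<in>B'. \<phi> (c' e) * monomial (W - {i}) h e) * y \<in> ideals.span (insert (h i) J)"
proof -
  let ?K = "ideals.span (insert (h i) J)"
  define j where "j = Min ((\<lambda>e. e i) ` B)"
  have "j \<in> (\<lambda>e. e i) ` B" unfolding j_def using X by (intro Min_in) auto
  moreover have jle: "j \<le> e i" if "e \<in> B" for e unfolding j_def using X that by auto
  define B0 where "B0 = {e \<in> B. e i = j}"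
  ultimately have B0: "B0 \<noteq> {}" "finite B0" unfolding B0_def using X(1) by auto
  define lower where "lower = (\<lambda>e::'a \<Rightarrow> nat. e(i := e i - j))"
  have mon: "monomial W h e = h i ^ j * monomial W h (lower e)" if "e \<in> B" for e
    using jle[OF that] W unfolding monomial_def lower_def
    by (simp add: prod.remove[of W i] power_add[symmetric] mult.assoc[symmetric])
  have pow: "x \<in> J" if "h i ^ m * x \<in> J" for m x
    using that by (induction m) (use nzd in \<open>auto simp: mult.assoc\<close>)
  let ?s = "\<lambda>A. \<Sum>e\<in>A. \<phi> (c e) * monomial W h (lower e)"
  have "(\<Sum>e\<in>B. \<phi> (c e) * monomial W h e) = h i ^ j * ?s B"
    unfolding sum_distrib_left by (intro sum.cong) (auto simp: mon algebra_simps)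
  then have sJ: "?s B * y \<in> J" using rel pow[of j "?s B * y"] by (simp add: mult.assoc)
  have JK: "J \<subseteq> ?K" using ideals.span_superset[of "insert (h i) J"] by auto
  have "?s (B - B0) \<in> ?K"
  proof (rule ideals.span_sum)
    fix e assume e: "e \<in> B - B0"
    then have "e i - j \<noteq> 0" using jle[of e] unfolding B0_def by auto
    then have "monomial W h (lower e) = h i ^ (e i - j - 1) * (\<Prod>k\<in>W-{i}. h k ^ lower e k) * h i"
      unfolding monomial_def using W
      by (subst prod.remove[of W i]) (auto simp: lower_def power_eq_if[of _ "e i - j"] mult_ac)
    then have "\<phi> (c e) * monomial W h (lower e) =
        (\<phi> (c e) * (h i ^ (e i - j - 1) * (\<Prod>k\<in>W-{i}. h k ^ lower e k))) * h i"
      by (simp add: mult.assoc)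
    moreover have "h i \<in> ?K" by (rule ideals.span_base) simp
    ultimately show "\<phi> (c e) * monomial W h (lower e) \<in> ?K"
      by (simp only: ideals.span_scale)
  qed
  moreover have "?s B = ?s B0 + ?s (B - B0)"
    using X(1) sum.subset_diff[of B0 B] by (simp add: B0_def add.commute)
  then have "?s B0 * y = ?s B * y - y * ?s (B - B0)" by (simp add: algebra_simps)
  ultimately have sK: "?s B0 * y \<in> ?K"
    by (simp only: ideals.span_diff[OF subsetD[OF JK sJ] ideals.span_scale])
  \<comment> \<open>On \<open>B0\<close> the exponent at i is constantly j, so erasing it is
    injective: no two terms merge and every coefficient stays nonzero.\<close>
  define z where "z = (\<lambda>e::'a \<Rightarrow> nat. e(i := 0))"
  have inj: "inj_on z B0"
  proof (rule inj_onI)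
    fix e e' assume e: "e \<in> B0" "e' \<in> B0" "z e = z e'"
    have "e k = e' k" for k
      using fun_cong[OF e(3), of k] e(1,2) by (cases "k = i") (auto simp: B0_def z_def)
    then show "e = e'" by (rule ext)
  qed
  have "(\<Sum>e\<in>z ` B0. \<phi> (c (inv_into B0 z e)) * monomial (W - {i}) h e) = ?s B0"
    unfolding sum.reindex[OF inj] o_def
  proof (rule sum.cong[OF refl])
    fix e assume e: "e \<in> B0"
    have "monomial W h (lower e) = monomial (W - {i}) h (z e)"
      using e W unfolding monomial_def
      by (subst prod.remove[of W i]) (auto simp: lower_def z_def B0_def intro!: prod.cong)
    then show "\<phi> (c (inv_into B0 z (z e))) * monomial (W - {i}) h (z e) = \<phi> (c e) * monomial W h (lower e)"
      using inj e by simp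
  qed
  then have "(\<Sum>e\<in>z ` B0. \<phi> (c (inv_into B0 z e)) * monomial (W - {i}) h e) * y \<in> ?K"
    using sK by simp
  moreover have "c (inv_into B0 z e) \<noteq> 0" if "e \<in> z ` B0" for e
    using that inv_into_into[OF that] by (intro c) (auto simp: B0_def)
  moreover have "\<forall>k. k \<notin> W - {i} \<longrightarrow> e k = 0" if "e \<in> z ` B0" for e
    using that X(3) by (auto simp: z_def B0_def)
  ultimately show ?thesis using B0 by (intro that[of "z ` B0" "c \<circ> inv_into B0 z"]) auto
qed

section \<open>Homogeneous polynomials and algebraic relations\<close>

definition total_degree :: "('v::finite \<Rightarrow>\<^sub>0 nat) \<Rightarrow> nat" where
  "total_degree e = (\<Sum>v\<in>UNIV. Poly_Mapping.lookup e v)"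

lemma total_degree_add: "total_degree (e + e') = total_degree e + total_degree e'"
  by (simp add: total_degree_def lookup_add sum.distrib)

lemma total_degree_0 [simp]: "total_degree 0 = 0"
  by (simp add: total_degree_def)

lemma homogeneous_iff_total_degree:
  "homogeneous_of_degree t p \<longleftrightarrow> (\<forall>e\<in>Poly_Mapping.keys p. total_degree e = t)"
  by (simp add: homogeneous_of_degree_def total_degree_def)

lemma homogeneous_mult:
  assumes "homogeneous_of_degree s p" "homogeneous_of_degree t q"
  shows "homogeneous_of_degree (s + t) (p * q)"
  using assms keys_mult[of p q] unfolding homogeneous_iff_total_degree
  by (force simp: total_degree_add)

lemma homogeneous_1: "homogeneous_of_degree 0 (1 :: ('v::{finite,linorder}, 'k::field) mpolyn)"
  by (simp add: homogeneous_iff_total_degree)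

lemma homogeneous_power: "homogeneous_of_degree t p \<Longrightarrow> homogeneous_of_degree (k * t) (p ^ k)"
  by (induction k) (auto intro: homogeneous_1 homogeneous_mult)

lemma homogeneous_monomial:
  assumes "finite V" "\<And>i. i \<in> V \<Longrightarrow> homogeneous_of_degree d (h i)"
  shows "homogeneous_of_degree (d * sum e V) (monomial V h e)"
  using assms unfolding monomial_def
proof (induction V rule: finite_induct)
  case empty
  show ?case by (simp add: homogeneous_1)
next
  case (insert i V)
  then have "homogeneous_of_degree (e i * d + d * sum e V) (h i ^ e i * (\<Prod>i\<in>V. h i ^ e i))"
    by (intro homogeneous_mult homogeneous_power) auto
  then show ?case using insert by (simp add: algebra_simps)
qed

text \<open>Truncation stands in for the decomposition into homogeneous components: it is additive,
  and a homogeneous factor of degree t merely shifts the bound by t. It therefore preserves ideals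
  with homogeneous generators.\<close>

definition truncate :: "nat \<Rightarrow> ('v::{finite,linorder}, 'k::field) mpolyn \<Rightarrow> ('v, 'k) mpolyn" where
  "truncate D p = Poly_Mapping.mapp (\<lambda>e c. if total_degree e \<le> D then c else 0) p"

lemma lookup_truncate:
  "Poly_Mapping.lookup (truncate D p) e = (if total_degree e \<le> D then Poly_Mapping.lookup p e else 0)"
  by (auto simp: truncate_def Poly_Mapping.lookup_mapp when_def in_keys_iff)

lemma truncate_add: "truncate D (p + q) = truncate D p + truncate D q"
  by (rule poly_mapping_eqI) (simp add: lookup_truncate lookup_add)

lemma truncate_zero [simp]: "truncate D 0 = 0"
  by (rule poly_mapping_eqI) (simp add: lookup_truncate)

lemma truncate_eq_self:
  "(\<And>e. e \<in> Poly_Mapping.keys p \<Longrightarrow> total_degree e \<le> D) \<Longrightarrow> truncate D p = p"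
  by (rule poly_mapping_eqI) (auto simp: lookup_truncate in_keys_iff)

lemma truncate_eq_0:
  "(\<And>e. e \<in> Poly_Mapping.keys p \<Longrightarrow> total_degree e > D) \<Longrightarrow> truncate D p = 0"
  by (rule poly_mapping_eqI) (metis in_keys_iff lookup_truncate lookup_zero not_le)

lemma truncate_mult_homogeneous:
  assumes m: "homogeneous_of_degree t m"
  shows "truncate D (c * m) = (if t \<le> D then truncate (D - t) c * m else 0)"
proof (cases "t \<le> D")
  case True
  define c1 where "c1 = truncate (D - t) c"
  define c2 where "c2 = c - c1"
  have deg: "\<exists>e1\<in>Poly_Mapping.keys q. total_degree e = total_degree e1 + t"
    if "e \<in> Poly_Mapping.keys (q * m)" for q e
    using that keys_mult[of q m] m by (force simp: homogeneous_iff_total_degree total_degree_add)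
  have "truncate D (c1 * m) = c1 * m"
  proof (rule truncate_eq_self)
    fix e assume "e \<in> Poly_Mapping.keys (c1 * m)"
    then obtain e1 where e1: "e1 \<in> Poly_Mapping.keys c1" "total_degree e = total_degree e1 + t"
      using deg by blast
    have "total_degree e1 \<le> D - t"
      using e1(1) by (auto simp: in_keys_iff c1_def lookup_truncate split: if_splits)
    then show "total_degree e \<le> D" using e1(2) True by simp
  qed
  moreover have "truncate D (c2 * m) = 0"
  proof (rule truncate_eq_0)
    fix e assume "e \<in> Poly_Mapping.keys (c2 * m)"
    then obtain e1 where e1: "e1 \<in> Poly_Mapping.keys c2" "total_degree e = total_degree e1 + t"
      using deg by blast
    have "total_degree e1 > D - t"
      using e1(1) by (auto simp: in_keys_iff c1_def c2_def lookup_truncate lookup_minus split: if_splits)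
    then show "total_degree e > D" using e1(2) True by simp
  qed
  moreover have "c * m = c1 * m + c2 * m" by (simp add: c2_def algebra_simps)
  ultimately show ?thesis using True by (simp add: truncate_add c1_def)
next
  case False
  have "truncate D (c * m) = 0"
  proof (rule truncate_eq_0)
    fix e assume "e \<in> Poly_Mapping.keys (c * m)"
    then show "total_degree e > D"
      using keys_mult[of c m] m False by (force simp: homogeneous_iff_total_degree total_degree_add)
  qed
  then show ?thesis using False by simp
qed

lemma truncate_span_homogeneous:
  assumes S: "\<And>m. m \<in> S \<Longrightarrow> \<exists>t. homogeneous_of_degree t m" and x: "x \<in> ideals.span S"
  shows "truncate D x \<in> ideals.span S"
  using x
proof (induction rule: ideals.span_induct_alt)
  case base
  show ?case by (simp add: ideals.span_zero)
next
  case (step c m w)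
  then obtain t where t: "homogeneous_of_degree t m" using S by blast
  have "truncate D (c * m) \<in> ideals.span S"
    unfolding truncate_mult_homogeneous[OF t] using step(1)
    by (auto intro: ideals.span_scale ideals.span_base ideals.span_zero)
  then show ?case unfolding truncate_add using step by (intro ideals.span_add)
qed

lemma truncate_span_eq_0:
  assumes S: "\<And>m. m \<in> S \<Longrightarrow> \<exists>t>D. homogeneous_of_degree t m" and x: "x \<in> ideals.span S"
  shows "truncate D x = 0"
  using x
proof (induction rule: ideals.span_induct_alt)
  case (step c m w)
  then obtain t where "t > D" "homogeneous_of_degree t m" using S by blast
  then show ?case using step truncate_mult_homogeneous[of t m D c] by (simp add: truncate_add)
qed simp

lemma exists_degree_bound: "\<exists>D. \<forall>e\<in>Poly_Mapping.keys p. total_degree e \<le> D"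
  by (rule exI[of _ "Max (total_degree ` Poly_Mapping.keys p)"]) simp

text \<open>A graded Krull intersection theorem. A power of \<open>h\<close> whose degree exceeds
  that of \<open>x\<close> is killed by truncation, so \<open>x\<close> is the truncation of
  \<open>z\<close>, which stays in the ideal.\<close>

lemma mem_span_if_mem_add_powers:
  assumes S: "\<And>m. m \<in> S \<Longrightarrow> \<exists>t. homogeneous_of_degree t m"
    and h: "homogeneous_of_degree d h" "d > 0"
    and x: "\<And>N. \<exists>v z. x = h ^ N * v + z \<and> z \<in> ideals.span S"
  shows "x \<in> ideals.span S"
proof -
  obtain D where D: "\<forall>e\<in>Poly_Mapping.keys x. total_degree e \<le> D"
    using exists_degree_bound by blast
  obtain v z where vz: "x = v * h ^ Suc D + z" "z \<in> ideals.span S"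
    using x[of "Suc D"] by (metis mult.commute)
  have "Suc D \<le> Suc D * d" using h(2) by (cases d) auto
  then have "\<not> Suc D * d \<le> D" by linarith
  then have "truncate D (v * h ^ Suc D) = 0"
    using truncate_mult_homogeneous[OF homogeneous_power[OF h(1)], of D v "Suc D"] by simp
  then have "truncate D x = truncate D z" unfolding vz(1) truncate_add by simp
  then have "x = truncate D z" using truncate_eq_self[of x D] D by simp
  then show ?thesis using truncate_span_homogeneous[OF S vz(2)] by simp
qed

text \<open>More vectors than coordinates are linearly dependent. The elements of \<open>A\<close>
  index vectors with coordinates in \<open>B\<close>; one coordinate is eliminated together with one
  pivot vector.\<close>

lemma exists_nontrivial_combination:
  fixes a :: "'x \<Rightarrow> 'y \<Rightarrow> 'k::field"
  assumes "finite B" "finite A" "card B < card A"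
  shows "\<exists>c. (\<exists>x\<in>A. c x \<noteq> 0) \<and> (\<forall>y\<in>B. (\<Sum>x\<in>A. c x * a x y) = 0)"
  using assms
proof (induction B arbitrary: A a rule: finite_induct)
  case empty
  then have "A \<noteq> {}" by auto
  then show ?case by (intro exI[of _ "\<lambda>_. 1"]) auto
next
  case (insert y B)
  show ?case
  proof (cases "\<forall>x\<in>A. a x y = 0")
    case True
    have "card B < card A" using insert by simp
    then obtain c where c: "\<exists>x\<in>A. c x \<noteq> 0" "\<forall>y\<in>B. (\<Sum>x\<in>A. c x * a x y) = 0"
      using insert.IH[OF insert.prems(1), of a] by blast
    have "(\<Sum>x\<in>A. c x * a x y) = 0" using True by simp
    then show ?thesis using c by blast
  next
    case False
    then obtain x0 where x0: "x0 \<in> A" "a x0 y \<noteq> 0" by blast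
    define a' where "a' = (\<lambda>x z. a x z - a x y / a x0 y * a x0 z)"
    have "card B < card (A - {x0})" using insert x0 by simp
    then obtain c where c: "\<exists>x\<in>A - {x0}. c x \<noteq> 0" "\<forall>z\<in>B. (\<Sum>x\<in>A - {x0}. c x * a' x z) = 0"
      using insert.IH[of "A - {x0}" a'] insert.prems(1) by blast
    \<comment> \<open>The coefficient of the pivot is the one that makes the combination vanish in
      coordinate y.\<close>
    define r where "r = - (\<Sum>x\<in>A - {x0}. c x * a x y) / a x0 y"
    define c' where "c' = c(x0 := r)"
    have eq: "(\<Sum>x\<in>A. c' x * a x z) = (\<Sum>x\<in>A - {x0}. c x * a' x z)" for z
    proof -
      have "(\<Sum>x\<in>A. c' x * a x z) = r * a x0 z + (\<Sum>x\<in>A - {x0}. c' x * a x z)"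
        using x0(1) insert.prems(1) by (simp add: sum.remove c'_def)
      also have "(\<Sum>x\<in>A - {x0}. c' x * a x z) = (\<Sum>x\<in>A - {x0}. c x * a x z)"
        by (rule sum.cong) (auto simp: c'_def)
      also have "r * a x0 z = - (\<Sum>x\<in>A - {x0}. c x * (a x y / a x0 y * a x0 z))"
        by (simp add: r_def sum_divide_distrib sum_distrib_left mult_ac)
      finally show ?thesis by (simp add: a'_def right_diff_distrib sum_subtractf)
    qed
    have "(\<Sum>x\<in>A. c' x * a x z) = 0" if z: "z \<in> insert y B" for z
    proof (cases "z = y")
      case True
      have "a' x y = 0" for x using x0 by (simp add: a'_def)
      then show ?thesis unfolding eq True by simp
    next
      case False
      then show ?thesis unfolding eq using c(2) z by blast
    qed
    moreover have "\<exists>x\<in>A. c' x \<noteq> 0" using c(1) by (auto simp: c'_def)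
    ultimately show ?thesis by blast
  qed
qed

section \<open>Algebraic dependence of more polynomials than variables\<close>

abbreviation const_poly :: "'k::field \<Rightarrow> ('v::{finite,linorder}, 'k) mpolyn" where
  "const_poly c \<equiv> Poly_Mapping.single 0 c"

lemma lookup_const_poly_mult: "Poly_Mapping.lookup (const_poly c * p) e = c * Poly_Mapping.lookup p e"
proof -
  have "const_poly c * p = Poly_Mapping.map ((*) c) p" by (simp add: mult_map_scale_conv_mult)
  then show ?thesis by (simp add: map.rep_eq when_def)
qed

text \<open>Each exponent is bounded separately instead of the total degree, so that the number of
  exponent vectors is bounded by a plain power.\<close>

definition degree_box :: "nat \<Rightarrow> ('v::finite \<Rightarrow>\<^sub>0 nat) set" where
  "degree_box D = {e. \<forall>v. Poly_Mapping.lookup e v \<le> D}"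

lemma degree_box_add: "e \<in> degree_box D \<Longrightarrow> e' \<in> degree_box D' \<Longrightarrow> e + e' \<in> degree_box (D + D')"
  by (auto simp: degree_box_def lookup_add intro: add_mono)

lemma keys_mult_degree_box:
  "Poly_Mapping.keys p \<subseteq> degree_box D \<Longrightarrow> Poly_Mapping.keys q \<subseteq> degree_box D' \<Longrightarrow>
    Poly_Mapping.keys (p * q) \<subseteq> degree_box (D + D')"
  using keys_mult[of p q] degree_box_add by blast

lemma keys_power_degree_box:
  "Poly_Mapping.keys p \<subseteq> degree_box D \<Longrightarrow> Poly_Mapping.keys (p ^ k) \<subseteq> degree_box (k * D)"
proof (induction k)
  case 0
  show ?case by (simp add: degree_box_def)
next
  case (Suc k)
  then show ?case using keys_mult_degree_box[of p D "p ^ k" "k * D"] by simp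
qed

lemma keys_monomial_degree_box:
  assumes "finite W" "\<And>i. i \<in> W \<Longrightarrow> Poly_Mapping.keys (h i) \<subseteq> degree_box D"
  shows "Poly_Mapping.keys (monomial W h e) \<subseteq> degree_box (sum e W * D)"
  using assms unfolding monomial_def
proof (induction W rule: finite_induct)
  case empty
  show ?case by (simp add: degree_box_def)
next
  case (insert i W)
  have "Poly_Mapping.keys (h i ^ e i * (\<Prod>j\<in>W. h j ^ e j)) \<subseteq> degree_box (e i * D + sum e W * D)"
    using insert by (intro keys_mult_degree_box keys_power_degree_box) auto
  then show ?case using insert.hyps by (simp add: algebra_simps)
qed

lemma card_degree_box:
  "finite (degree_box D :: ('v::finite \<Rightarrow>\<^sub>0 nat) set)"
  "card (degree_box D :: ('v::finite \<Rightarrow>\<^sub>0 nat) set) \<le> (D + 1) ^ CARD('v)"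
proof -
  let ?P = "PiE (UNIV :: 'v set) (\<lambda>_. {..D})"
  have inj: "inj_on Poly_Mapping.lookup (degree_box D :: ('v \<Rightarrow>\<^sub>0 nat) set)"
    by (rule inj_onI) (simp only: poly_mapping_eq_iff)
  have sub: "Poly_Mapping.lookup ` (degree_box D :: ('v \<Rightarrow>\<^sub>0 nat) set) \<subseteq> ?P"
    by (auto simp: degree_box_def)
  have fin: "finite ?P" by (rule finite_PiE) auto
  show "finite (degree_box D :: ('v::finite \<Rightarrow>\<^sub>0 nat) set)"
    using finite_imageD[OF finite_subset[OF sub fin] inj] .
  have "card (degree_box D :: ('v \<Rightarrow>\<^sub>0 nat) set) \<le> card ?P"
    using card_mono[OF fin sub] card_image[OF inj] by simp
  also have "card ?P = (D + 1) ^ CARD('v)" by (subst card_PiE) auto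
  finally show "card (degree_box D :: ('v::finite \<Rightarrow>\<^sub>0 nat) set) \<le> (D + 1) ^ CARD('v)" .
qed

text \<open>There are more monomials in \<open>h\<close> with exponents below \<open>M\<close> than dimensions available to them.\<close>

lemma exists_algebraic_relation:
  fixes h :: "'i \<Rightarrow> ('v::{finite,linorder}, 'k::field) mpolyn"
  assumes W: "finite W" "CARD('v) < card W"
  obtains B and c :: "('i \<Rightarrow> nat) \<Rightarrow> 'k" where "finite B" "B \<noteq> {}"
    "\<And>e. e \<in> B \<Longrightarrow> \<forall>j. j \<notin> W \<longrightarrow> e j = 0" "\<And>e. e \<in> B \<Longrightarrow> c e \<noteq> 0"
    "(\<Sum>e\<in>B. const_poly (c e) * monomial W h e) = 0"
proof -
  let ?w = "card W" and ?n = "CARD('v)"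
  have "\<exists>D. \<forall>i\<in>W. Poly_Mapping.keys (h i) \<subseteq> degree_box D"
  proof -
    define D where "D = (\<Sum>i\<in>W. \<Sum>e\<in>Poly_Mapping.keys (h i). \<Sum>v\<in>UNIV. Poly_Mapping.lookup e v)"
    have "Poly_Mapping.lookup e v \<le> D" if "i \<in> W" "e \<in> Poly_Mapping.keys (h i)" for i e v
    proof -
      have "Poly_Mapping.lookup e v \<le> (\<Sum>v\<in>UNIV. Poly_Mapping.lookup e v)"
        by (rule member_le_sum) auto
      also have "\<dots> \<le> (\<Sum>e\<in>Poly_Mapping.keys (h i). \<Sum>v\<in>UNIV. Poly_Mapping.lookup e v)"
        using that by (intro member_le_sum[of e]) auto
      also have "\<dots> \<le> D" unfolding D_def using that W
        by (intro member_le_sum[of i W "\<lambda>i. \<Sum>e\<in>Poly_Mapping.keys (h i). \<Sum>v\<in>UNIV. Poly_Mapping.lookup e v"]) auto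
      finally show ?thesis .
    qed
    then show ?thesis by (auto simp: degree_box_def)
  qed
  then obtain D where D: "\<And>i. i \<in> W \<Longrightarrow> Poly_Mapping.keys (h i) \<subseteq> degree_box D" by blast
  \<comment> \<open>There are \<open>M ^ ?w\<close> products, hence at least M^(n+2) for n + 1
    variables, and they live in a space of dimension at most ((w D + 1) M)^(n+1). Making M exceed (w
    D + 1)^(n+1) tips the balance.\<close>
  define M where "M = (?w * D + 1) ^ ?n + 1"
  \<comment> \<open>Functions in \<open>PiE\<close> are undefined outside \<open>W\<close>;
    extending them by 0 gives the exponents the required support.\<close>
  define ext where "ext = (\<lambda>g :: 'i \<Rightarrow> nat. \<lambda>i. if i \<in> W then g i else 0)"
  define A where "A = ext ` PiE W (\<lambda>_. {..<M})"
  have inj: "inj_on ext (PiE W (\<lambda>_. {..<M}))"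
  proof (rule inj_onI)
    fix g g' assume g: "g \<in> PiE W (\<lambda>_. {..<M})" "g' \<in> PiE W (\<lambda>_. {..<M})" "ext g = ext g'"
    show "g = g'"
    proof (rule PiE_ext[OF g(1,2)])
      fix i assume "i \<in> W"
      then show "g i = g' i" using fun_cong[OF g(3), of i] by (simp add: ext_def)
    qed
  qed
  have finA: "finite A" unfolding A_def using W by (intro finite_imageI finite_PiE) auto
  have cardA: "card A = M ^ ?w" unfolding A_def using inj W by (simp add: card_image card_PiE)
  have suppA: "\<forall>j. j \<notin> W \<longrightarrow> e j = 0" and ltA: "\<forall>j\<in>W. e j < M" if "e \<in> A" for e
    using that unfolding A_def ext_def by (auto simp: PiE_iff)
  let ?D = "?w * M * D"
  let ?X = "degree_box ?D :: ('v \<Rightarrow>\<^sub>0 nat) set"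
  have keys: "Poly_Mapping.keys (monomial W h e) \<subseteq> ?X" if "e \<in> A" for e
  proof -
    have "sum e W \<le> (\<Sum>i\<in>W. M)" using ltA[OF that] by (intro sum_mono) (simp add: less_imp_le)
    then have "sum e W \<le> ?w * M" by simp
    then have "sum e W * D \<le> ?D" by (rule mult_right_mono) simp
    then have "degree_box (sum e W * D) \<subseteq> ?X" unfolding degree_box_def using le_trans by blast
    moreover have "Poly_Mapping.keys (monomial W h e) \<subseteq> degree_box (sum e W * D)"
      using W(1) D by (rule keys_monomial_degree_box)
    ultimately show ?thesis by blast
  qed
  have M1: "M \<ge> 1" by (simp add: M_def)
  have "card ?X \<le> (?D + 1) ^ ?n" by (rule card_degree_box)
  also have "?D + 1 \<le> (?w * D + 1) * M"
    using M1 by (simp add: algebra_simps)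
  then have "(?D + 1) ^ ?n \<le> ((?w * D + 1) * M) ^ ?n" by (rule power_mono) simp
  also have "\<dots> = (?w * D + 1) ^ ?n * M ^ ?n" by (rule power_mult_distrib)
  also have "\<dots> < M * M ^ ?n" using M1 by (intro mult_strict_right_mono) (auto simp: M_def)
  also have "\<dots> = M ^ Suc ?n" by simp
  also have "\<dots> \<le> M ^ ?w" using W M1 by (intro power_increasing) auto
  finally have "card ?X < card A" unfolding cardA .
  then obtain c where c: "\<exists>e\<in>A. c e \<noteq> 0"
    "\<forall>x\<in>?X. (\<Sum>e\<in>A. c e * Poly_Mapping.lookup (monomial W h e) x) = 0"
    using exists_nontrivial_combination[OF card_degree_box(1) finA,
        of ?D "\<lambda>e x. Poly_Mapping.lookup (monomial W h e) x"] by blast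
  define B where "B = {e \<in> A. c e \<noteq> 0}"
  have "(\<Sum>e\<in>A. const_poly (c e) * monomial W h e) = 0"
  proof (rule poly_mapping_eqI)
    fix x :: "'v \<Rightarrow>\<^sub>0 nat"
    have "(\<Sum>e\<in>A. c e * Poly_Mapping.lookup (monomial W h e) x) = 0"
    proof (cases "x \<in> ?X")
      case False
      then have "Poly_Mapping.lookup (monomial W h e) x = 0" if "e \<in> A" for e
        using keys[OF that] by (auto simp: in_keys_iff)
      then show ?thesis by simp
    qed (use c in blast)
    then show "Poly_Mapping.lookup (\<Sum>e\<in>A. const_poly (c e) * monomial W h e) x = Poly_Mapping.lookup 0 x"
      by (simp add: lookup_sum lookup_const_poly_mult)
  qed
  also have "(\<Sum>e\<in>A. const_poly (c e) * monomial W h e) = (\<Sum>e\<in>B. const_poly (c e) * monomial W h e)"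
    unfolding B_def using finA by (intro sum.mono_neutral_right) auto
  finally show ?thesis using c(1) finA suppA by (intro that[of B c]) (auto simp: B_def)
qed

section \<open>Primes over complete intersections\<close>

locale generic_family = permutable_regular V0 f "CARD('v)"
  for V0 :: "nat set" and f :: "nat \<Rightarrow> ('v::{finite,linorder}, 'k::field) mpolyn" +
  fixes d :: nat
  assumes d_pos: "d > 0" and homogeneous: "\<And>i. i \<in> V0 \<Longrightarrow> homogeneous_of_degree d (f i)"
begin

lemma homogeneous_mon: "homogeneous_of_degree (d * sum e V0) (mon e)"
  using homogeneous_monomial[OF fin homogeneous] .

lemma L_insert:
  assumes "insert i U \<subseteq> V0" "i \<notin> U" "i \<notin> T"
  shows "ideals.span (insert (f i) (L U T k)) \<subseteq> L (insert i U) T k"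
    and "x \<in> L (insert i U) T k \<Longrightarrow> \<exists>v. \<exists>z\<in>L U T k. x = f i * v + z"
proof -
  have iV: "i \<in> V0" and finU: "finite U" using assms finite_sub by auto
  show "ideals.span (insert (f i) (L U T k)) \<subseteq> L (insert i U) T k"
  proof (rule ideals.span_minimal)
    have "1 \<in> MI (\<lambda>e. True)"
      using monomial_in_monomial_ideal[of "\<lambda>_. True" "\<lambda>_. 0" V0 f] by (simp add: monomial_0)
    then have "f i * 1 \<in> L (insert i U) T k" unfolding L_def
      by (rule monomial_ideal_mult_gen[OF fin iV]) (use finU assms in simp)
    moreover have "L U T k \<subseteq> L (insert i U) T k"
      unfolding L_def by (rule monomial_ideal_mono) (use finU assms in auto)
    ultimately show "insert (f i) (L U T k) \<subseteq> L (insert i U) T k" by simp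
  qed simp
  assume x: "x \<in> L (insert i U) T k"
  obtain v z where vz: "x = f i * v + z"
    "z \<in> MI (\<lambda>e. (1 \<le> sum e (insert i U) \<or> k \<le> sum e T) \<and> e i = 0)"
    by (rule monomial_ideal_split[OF fin iV x[unfolded L_def]])
  have "z \<in> L U T k" unfolding L_def using vz(2)
    by (rule monomial_ideal_weaken) (use finU assms(2) in \<open>auto split: if_splits\<close>)
  then show "\<exists>v. \<exists>z\<in>L U T k. x = f i * v + z" using vz(1) by blast
qed

text \<open>Modulo \<open>f i\<close> the polynomial loses a variable, which gives \<open>y = f i * v + z\<close> with \<open>z\<close> in the
  ideal and \<open>v\<close> as good as \<open>y\<close>; iterating, \<open>y\<close> lies in the ideal modulo every power of \<open>f i\<close>.\<close>

lemma nonzero_polynomial_nonzerodivisor: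
  assumes "finite W" "W \<subseteq> V0" "U \<subseteq> V0" "T \<subseteq> V0" "U \<inter> T = {}" "W \<inter> (U \<union> T) = {}"
    and "card U + card T + card W \<le> CARD('v)"
    and "finite B" "B \<noteq> {}" "\<And>e. e \<in> B \<Longrightarrow> \<forall>j. j \<notin> W \<longrightarrow> e j = 0" "\<And>e. e \<in> B \<Longrightarrow> c e \<noteq> 0"
    and "(\<Sum>e\<in>B. const_poly (c e) * monomial W f e) * y \<in> L U T k"
  shows "y \<in> L U T k"
  using assms
proof (induction W arbitrary: U B c y rule: finite_induct)
  case empty
  \<comment> \<open>With no index left, the polynomial is a nonzero constant, hence a unit.\<close>
  have "e = (\<lambda>_. 0)" if "e \<in> B" for e
    by (rule ext) (use empty.prems(9)[OF that] in simp)
  then have B: "B = {\<lambda>_. 0}" using empty.prems(8) by blast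
  then have c: "c (\<lambda>_. 0) \<noteq> 0" using empty.prems(10) by simp
  have "const_poly (c (\<lambda>_. 0)) * y \<in> L U T k"
    using empty.prems(11) unfolding B by (simp add: monomial_0)
  then have "const_poly (inverse (c (\<lambda>_. 0))) * (const_poly (c (\<lambda>_. 0)) * y) \<in> L U T k"
    by (rule ideals.subspace_scale[OF subspace_L])
  moreover have "const_poly (inverse (c (\<lambda>_. 0))) * const_poly (c (\<lambda>_. 0)) = (1 :: ('v, 'k) mpolyn)"
    using c by (simp add: mult_single)
  ultimately show ?case by (simp add: mult.assoc[symmetric])
next
  case (insert i W)
  define p where "p = (\<Sum>e\<in>B. const_poly (c e) * monomial (insert i W) f e)"
  have iV: "i \<in> V0" "i \<notin> U" "i \<notin> T" using insert.prems(1,5) by auto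
  have finU: "finite U" using insert.prems(2) by (rule finite_sub)
  have cardUT: "card U + card T < CARD('v)" using insert.prems(6) insert.hyps by simp
  have nzd: "v \<in> L U T k" if "f i * v \<in> L U T k" for v
    using colon_notin[OF insert.prems(2,3,4) iV cardUT that] .
  have step: "\<exists>v. \<exists>z\<in>L U T k. u = f i * v + z \<and> p * v \<in> L U T k" if u: "p * u \<in> L U T k" for u
  proof -
    obtain B' c' where B': "finite B'" "B' \<noteq> {}"
      "\<And>e. e \<in> B' \<Longrightarrow> \<forall>j. j \<notin> insert i W - {i} \<longrightarrow> e j = 0"
      "\<And>e. e \<in> B' \<Longrightarrow> c' e \<noteq> 0"
      "(\<Sum>e\<in>B'. const_poly (c' e) * monomial (insert i W - {i}) f e) * u
        \<in> ideals.span (insert (f i) (L U T k))"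
      by (rule reduce_relation[where J = "L U T k" and W = "insert i W" and h = f and i = i
            and B = B and c = c and \<phi> = const_poly and y = u])
        (use insert.prems(7-10) insert.hyps nzd u in \<open>auto simp: p_def\<close>)
    have Wi: "insert i W - {i} = W" using insert.hyps by auto
    have iU: "insert i U \<subseteq> V0" using iV insert.prems(2) by auto
    have "u \<in> L (insert i U) T k"
    proof (rule insert.IH[where B = B' and c = c'])
      show "(\<Sum>e\<in>B'. const_poly (c' e) * monomial W f e) * u \<in> L (insert i U) T k"
        using B'(5) L_insert(1)[OF iU iV(2,3), of k] unfolding Wi by blast
      show "card (insert i U) + card T + card W \<le> CARD('v)"
        using insert.prems(6) insert.hyps iV finU by simp
      show "insert i U \<inter> T = {}" "W \<inter> (insert i U \<union> T) = {}"
        using insert.prems(4,5) insert.hyps iV by auto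
      show "\<forall>j. j \<notin> W \<longrightarrow> e j = 0" if "e \<in> B'" for e using B'(3)[OF that] unfolding Wi .
    qed (use iU insert.prems(1,3) B' in auto)
    then obtain v z where vz: "z \<in> L U T k" "u = f i * v + z"
      using L_insert(2)[OF iU iV(2,3)] by blast
    have "f i * (p * v) = p * u - p * z" unfolding vz(2) by (simp add: algebra_simps)
    also have "\<dots> \<in> L U T k"
      by (rule ideals.subspace_diff[OF subspace_L u ideals.subspace_scale[OF subspace_L vz(1)]])
    finally have "p * v \<in> L U T k" by (rule nzd)
    then show ?thesis using vz by blast
  qed
  have pow: "\<exists>v. \<exists>z\<in>L U T k. y = f i ^ m * v + z \<and> p * v \<in> L U T k" for m
  proof (induction m)
    case 0
    have "p * y \<in> L U T k" using insert.prems(11) by (simp add: p_def)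
    then show ?case by (intro exI[of _ y] bexI[of _ 0]) (auto intro: ideals.subspace_0)
  next
    case (Suc m)
    then obtain v z where vz: "z \<in> L U T k" "y = f i ^ m * v + z" "p * v \<in> L U T k" by blast
    obtain v' z' where vz': "z' \<in> L U T k" "v = f i * v' + z'" "p * v' \<in> L U T k"
      using step[OF vz(3)] by blast
    have "y = f i ^ Suc m * v' + (f i ^ m * z' + z)"
      unfolding vz(2) vz'(2) by (simp add: algebra_simps)
    moreover have "f i ^ m * z' + z \<in> L U T k"
      by (rule ideals.subspace_add[OF subspace_L ideals.subspace_scale[OF subspace_L vz'(1)] vz(1)])
    ultimately show ?case using vz'(3) by blast
  qed
  show ?case unfolding L_def monomial_ideal_def
  proof (rule mem_span_if_mem_add_powers[OF _ homogeneous[OF iV(1)] d_pos])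
    show "\<exists>t. homogeneous_of_degree t m" if "m \<in> {mon e |e. 1 \<le> sum e U \<or> k \<le> sum e T}" for m
      using that homogeneous_mon by auto
    show "\<exists>v z. y = f i ^ m * v + z \<and> z \<in> ideals.span {mon e |e. 1 \<le> sum e U \<or> k \<le> sum e T}" for m
      using pow[of m] unfolding L_def monomial_ideal_def by blast
  qed
qed

lemma prime_contains_factor:
  assumes p: "primeideal p ring_of_type_algebra" and "finite V" "monomial V h e \<in> p"
  shows "\<exists>i\<in>V. e i > 0 \<and> h i \<in> p"
  using assms(2,3)
proof (induction V rule: finite_induct)
  case empty
  then show ?case using p by (simp add: monomial_def primeideal_iff)
next
  case (insert i V)
  have pow: "m > 0 \<and> x \<in> p" if "x ^ m \<in> p" for x and m :: nat
    using that p by (induction m) (auto simp: primeideal_iff)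
  have "h i ^ e i * monomial V h e \<in> p"
    using insert.prems insert.hyps by (simp add: monomial_def)
  then have "h i ^ e i \<in> p \<or> monomial V h e \<in> p" using p by (simp add: primeideal_iff)
  then show ?case using pow[of "h i" "e i"] insert.IH by auto
qed

lemma L_subset_prime:
  assumes "primeideal p ring_of_type_algebra" "f ` T \<subseteq> p" "T \<subseteq> V0" "j > 0"
  shows "L {} T j \<subseteq> p"
proof -
  have "L {} T j \<subseteq> MI (\<lambda>e. 1 \<le> sum e T)"
    unfolding L_def by (rule monomial_ideal_mono) (use assms(4) in auto)
  also have "\<dots> = ideals.span (f ` T)" using span_image_eq_monomial_ideal[OF fin assms(3)] ..
  also have "\<dots> \<subseteq> p" using assms(1,2) by (intro ideals.span_minimal) (auto simp: primeideal_iff)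
  finally show ?thesis .
qed

lemma L_mult:
  assumes "x \<in> L {} T j" "y \<in> L {} T j'" shows "x * y \<in> L {} T (j + j')"
proof (rule span_mult_mem[OF assms[unfolded L_def monomial_ideal_def] subspace_L])
  fix u v assume "u \<in> {mon e |e. 1 \<le> sum e {} \<or> j \<le> sum e T}" "v \<in> {mon e |e. 1 \<le> sum e {} \<or> j' \<le> sum e T}"
  then obtain e e' where "u = mon e" "j \<le> sum e T" "v = mon e'" "j' \<le> sum e' T" by auto
  then show "u * v \<in> L {} T (j + j')" unfolding L_def monomial_add[symmetric]
    by (auto intro!: monomial_in_monomial_ideal simp: monomial_add[symmetric] sum.distrib)
qed

text \<open>Modulo a prime over \<open>(f\<^sub>i : i \<in> T)\<close>, every \<open>x\<close> is algebraic over the \<open>f\<^sub>i\<close> with \<open>i \<in> W\<close>,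
  because there are too few variables for \<open>x\<close> and all \<open>f\<^sub>i\<close> to be algebraically independent.\<close>

lemma prime_over_contains_polynomial:
  assumes T: "T \<subseteq> V0" "W \<subseteq> V0" "T \<inter> W = {}" "card T + card W = CARD('v)"
    and q: "primeideal q ring_of_type_algebra" "f ` T \<subseteq> q"
    and p: "ideals.subspace p" "q \<subseteq> p" "x \<in> p" "x \<notin> q"
  obtains B c where "finite B" "B \<noteq> {}" "\<And>e. e \<in> B \<Longrightarrow> \<forall>j. j \<notin> W \<longrightarrow> e j = 0"
    "\<And>e. e \<in> B \<Longrightarrow> c e \<noteq> 0" "(\<Sum>e\<in>B. const_poly (c e) * monomial W f e) \<in> p"
proof -
  \<comment> \<open>A fresh index for \<open>x\<close>, so that \<open>x\<close> and the f_i form a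
    single family \<open>h\<close>.\<close>
  obtain z where z: "z \<notin> V0" using fin ex_new_if_finite[OF infinite_UNIV_nat] by blast
  define h where "h = f(z := x)"
  have hf: "h i = f i" if "i \<in> V0" for i using that z by (auto simp: h_def)
  have finTW: "finite T" "finite W" using T finite_sub by auto
  \<comment> \<open>A relation between \<open>x\<close> and all f_i with i in W or T exists by
    counting. The f_t with t \<in> T are then set to zero one after the other; each is regular
    modulo those already removed, which keeps the relation nontrivial.\<close>
  have "\<exists>B c. finite B \<and> B \<noteq> {} \<and> (\<forall>e\<in>B. \<forall>j. j \<notin> insert z (W \<union> T - U) \<longrightarrow> e j = 0) \<and>
      (\<forall>e\<in>B. c e \<noteq> 0) \<and>
      (\<Sum>e\<in>B. const_poly (c e) * monomial (insert z (W \<union> T - U)) h e) \<in> ideals.span (f ` U)"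
    if "U \<subseteq> T" for U
    using finite_subset[OF that finTW(1)] that
  proof (induction U rule: finite_induct)
    case empty
    have "z \<notin> W \<union> T" using z T by auto
    then have "card (insert z (W \<union> T)) = Suc (card W + card T)"
      using finTW T(3) by (simp add: card_Un_disjoint Int_commute)
    then have "CARD('v) < card (insert z (W \<union> T))" using T(4) by simp
    then obtain B c where "finite B" "B \<noteq> {}" "\<And>e. e \<in> B \<Longrightarrow> \<forall>j. j \<notin> insert z (W \<union> T) \<longrightarrow> e j = 0"
      "\<And>e. e \<in> B \<Longrightarrow> c e \<noteq> 0"
      "(\<Sum>e\<in>B. const_poly (c e) * monomial (insert z (W \<union> T)) h e) = 0"
      using exists_algebraic_relation[of "insert z (W \<union> T)" h] finTW by blast
    then show ?case by (intro exI[of _ B] exI[of _ c]) auto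
  next
    case (insert t U)
    then have "U \<subseteq> T" by auto
    from insert.IH[OF this] obtain B c where B: "finite B" "B \<noteq> {}"
      "\<forall>e\<in>B. \<forall>j. j \<notin> insert z (W \<union> T - U) \<longrightarrow> e j = 0" "\<forall>e\<in>B. c e \<noteq> 0"
      "(\<Sum>e\<in>B. const_poly (c e) * monomial (insert z (W \<union> T - U)) h e) \<in> ideals.span (f ` U)"
      by (elim exE conjE)
    have t: "t \<in> V0" "t \<in> T" "t \<noteq> z" "t \<notin> U" using insert.prems insert.hyps T z by auto
    have "card U < card T" using insert finTW t by (intro psubset_card_mono) auto
    then have "card U < CARD('v)" using T(4) by simp
    then have nzd: "y \<in> ideals.span (f ` U)" if "h t * y \<in> ideals.span (f ` U)" for y
      using reg[of U t y] insert.prems T t that hf[of t] by auto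
    obtain B' c' where B': "finite B'" "B' \<noteq> {}"
      "\<And>e. e \<in> B' \<Longrightarrow> \<forall>j. j \<notin> insert z (W \<union> T - U) - {t} \<longrightarrow> e j = 0" "\<And>e. e \<in> B' \<Longrightarrow> c' e \<noteq> 0"
      "(\<Sum>e\<in>B'. const_poly (c' e) * monomial (insert z (W \<union> T - U) - {t}) h e) * 1
        \<in> ideals.span (insert (h t) (ideals.span (f ` U)))"
      by (rule reduce_relation[where J = "ideals.span (f ` U)" and W = "insert z (W \<union> T - U)"
            and h = h and i = t and B = B and c = c and \<phi> = const_poly and y = 1])
        (use B t finTW nzd in auto)
    have W': "insert z (W \<union> T - U) - {t} = insert z (W \<union> T - insert t U)" using t by auto
    have "insert (h t) (ideals.span (f ` U)) \<subseteq> ideals.span (f ` insert t U)"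
      using ideals.span_mono[of "f ` U" "f ` insert t U"] hf[OF t(1)]
      by (auto intro: ideals.span_base)
    then have "ideals.span (insert (h t) (ideals.span (f ` U))) \<subseteq> ideals.span (f ` insert t U)"
      by (intro ideals.span_minimal) auto
    then show ?case using B' unfolding W' by (intro exI[of _ B'] exI[of _ c']) auto
  qed
  from this[OF subset_refl] obtain B c where B: "finite B" "B \<noteq> {}"
    "\<forall>e\<in>B. \<forall>j. j \<notin> insert z (W \<union> T - T) \<longrightarrow> e j = 0" "\<forall>e\<in>B. c e \<noteq> 0"
    "(\<Sum>e\<in>B. const_poly (c e) * monomial (insert z (W \<union> T - T)) h e) \<in> ideals.span (f ` T)"
    by (elim exE conjE)
  have WT: "W \<union> T - T = W" using T(3) by auto
  note B = B[unfolded WT]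
  have qI: "ideals.subspace q" using q(1) by (simp add: primeideal_iff)
  have "ideals.span (f ` T) \<subseteq> q" using q(2) qI by (rule ideals.span_minimal)
  then have Bq: "(\<Sum>e\<in>B. const_poly (c e) * monomial (insert z W) h e) * 1 \<in> q" using B(5) by auto
  have fz: "finite (insert z W)" "z \<in> insert z W" using finTW by auto
  \<comment> \<open>Last, \<open>x\<close> itself is eliminated: it is a nonzerodivisor modulo the
    prime \<open>q\<close> because it lies outside, and setting it to zero is harmless modulo
    \<open>p\<close> because it lies in \<open>p\<close>.\<close>
  have nzd: "y \<in> q" if "h z * y \<in> q" for y
    using that q(1) p(4) by (auto simp: h_def primeideal_iff)
  have zW: "insert z W - {z} = W" using z T(2) by auto
  obtain B' c' where B': "finite B'" "B' \<noteq> {}"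
    "\<And>e. e \<in> B' \<Longrightarrow> \<forall>j. j \<notin> W \<longrightarrow> e j = 0" "\<And>e. e \<in> B' \<Longrightarrow> c' e \<noteq> 0"
    "(\<Sum>e\<in>B'. const_poly (c' e) * monomial W h e) * 1 \<in> ideals.span (insert (h z) q)"
    by (rule reduce_relation[where J = q and W = "insert z W" and h = h and i = z and B = B
          and c = c and \<phi> = const_poly and y = 1, unfolded zW])
      (use fz qI nzd B Bq in auto)
  have "ideals.span (insert (h z) q) \<subseteq> p"
    using p by (intro ideals.span_minimal) (auto simp: h_def)
  moreover have "monomial W h e = monomial W f e" for e
    unfolding monomial_def using hf T(2) by (intro prod.cong) auto
  ultimately show ?thesis
    using B' that[of B' c'] by auto
qed

end

section \<open>Symbolic powers of fold products\<close>

lemma exists_between_with_sum: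
  fixes lo hi :: "'i \<Rightarrow> nat"
  assumes "finite V" "\<And>i. i \<in> V \<Longrightarrow> lo i \<le> hi i" "sum lo V \<le> a" "a \<le> sum hi V"
  obtains g where "\<And>i. i \<in> V \<Longrightarrow> lo i \<le> g i \<and> g i \<le> hi i" "sum g V = a"
proof -
  have "\<exists>g. (\<forall>i\<in>V. lo i \<le> g i \<and> g i \<le> hi i) \<and> sum g V = a"
    using assms
  proof (induction V arbitrary: a rule: finite_induct)
    case empty
    then show ?case by simp
  next
    case (insert j V)
    \<comment> \<open>Greedy choice: index j takes as much as it may while leaving the lower bounds
      of the other indices payable.\<close>
    define t where "t = min (hi j) (a - sum lo V)"
    have s: "sum lo (insert j V) = lo j + sum lo V" "sum hi (insert j V) = hi j + sum hi V"
      using insert.hyps by auto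
    have "sum lo V \<le> sum hi V" using insert.prems(1) by (intro sum_mono) simp
    then have t: "lo j \<le> t" "t \<le> hi j" "t \<le> a" "sum lo V \<le> a - t" "a - t \<le> sum hi V"
      using insert.prems(2,3) insert.prems(1)[of j] unfolding s t_def by auto
    obtain g where g: "\<forall>i\<in>V. lo i \<le> g i \<and> g i \<le> hi i" "sum g V = a - t"
      using insert.IH[OF _ t(4,5)] insert.prems(1) by auto
    have "sum (g(j := t)) V = sum g V" using insert.hyps by (intro sum.cong) auto
    then have "sum (g(j := t)) (insert j V) = a" using g t insert.hyps by simp
    then show ?case using g t insert.hyps by (intro exI[of _ "g(j := t)"]) auto
  qed
  then show ?thesis using that by blast
qed

text \<open>Averaging over c-subsets, done by removing one index at a time: the bounds for all V -
  {i} are added up, and the common factor |V| - 1 cancels.\<close>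

lemma card_mult_le_if_subset_sums_ge:
  fixes e :: "'i \<Rightarrow> nat"
  assumes "finite V" "1 \<le> c" "c \<le> card V" "\<And>T. T \<subseteq> V \<Longrightarrow> card T = c \<Longrightarrow> k \<le> sum e T"
  shows "card V * k \<le> c * sum e V"
  using assms
proof (induction "card V" arbitrary: V)
  case 0
  then show ?case by simp
next
  case (Suc m)
  show ?case
  proof (cases "c = card V")
    case True
    then show ?thesis using Suc.prems(4)[of V] by (auto intro: mult_left_mono)
  next
    case False
    have step: "m * k + c * e i \<le> c * sum e V" if i: "i \<in> V" for i
    proof -
      have m: "m = card (V - {i})" using Suc.hyps(2) Suc.prems(1) i by simp
      have "card (V - {i}) * k \<le> c * sum e (V - {i})"
        by (rule Suc.hyps(1)[OF m])
          (use Suc.prems False Suc.hyps(2) m in \<open>auto intro!: Suc.prems(4)\<close>)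
      moreover have "sum e V = e i + sum e (V - {i})" using Suc.prems(1) i by (rule sum.remove)
      ultimately show ?thesis unfolding m by (simp add: distrib_left)
    qed
    have "(\<Sum>i\<in>V. m * k + c * e i) \<le> (\<Sum>i\<in>V. c * sum e V)" using step by (rule sum_mono)
    then have "Suc m * (m * k) + c * sum e V \<le> Suc m * (c * sum e V)"
      unfolding sum.distrib using Suc.hyps(2) by (simp flip: sum_distrib_left)
    then have "m * (Suc m * k) \<le> m * (c * sum e V)" by (simp add: algebra_simps)
    moreover have "m > 0" using False Suc.prems(2,3) Suc.hyps(2) by simp
    ultimately show ?thesis using Suc.hyps(2) by simp
  qed
qed

definition nonzerodivisors :: "'a::comm_ring_1 set \<Rightarrow> 'a set" where
  "nonzerodivisors Q = {u. \<forall>y. u * y \<in> Q \<longrightarrow> y \<in> Q}"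

lemma nonzerodivisors_1: "1 \<in> nonzerodivisors Q"
  by (simp add: nonzerodivisors_def)

lemma nonzerodivisors_mult:
  "u \<in> nonzerodivisors Q \<Longrightarrow> v \<in> nonzerodivisors Q \<Longrightarrow> u * v \<in> nonzerodivisors Q"
  unfolding nonzerodivisors_def mem_Collect_eq mult.assoc by blast

text \<open>Dividing a - 1 by b gives quotient s - c and remainder \<mu> - 1, so b (s - c) < a \<le>
  b (s - c + 1). Any c of the f_i thus carry total exponent at least \<mu> in each generator,
  whereas s - c + 1 of them can carry all of a. The bound \<open>c < CARD('v)\<close> leaves every
  further f_j regular modulo c of them.\<close>

locale fold_ideal = generic_family V0 f d
  for V0 :: "nat set" and f :: "nat \<Rightarrow> ('v::{finite,linorder}, 'k::field) mpolyn" and d :: nat +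
  fixes a b c \<mu> :: nat
  assumes a_eq: "a = b * (card V0 - c) + \<mu>" and \<mu>: "1 \<le> \<mu>" "\<mu> \<le> b"
    and c: "1 \<le> c" "c < CARD('v)" and card_V0: "CARD('v) \<le> card V0"
begin

definition I :: "('v, 'k) mpolyn set" where
  "I = MI (\<lambda>e. (\<forall>i\<in>V0. e i \<le> b) \<and> sum e V0 = a)"

lemma subspace_I [simp]: "ideals.subspace I"
  by (simp add: I_def)

lemma subspace_I_power [simp]: "ideals.subspace (ideal_power I r)"
  by (rule subspace_ideal_power) simp

lemma a_le: "a \<le> b * (card V0 - c + 1)" "a \<le> b * card V0"
proof -
  show "a \<le> b * (card V0 - c + 1)" using a_eq \<mu> by simp
  also have "\<dots> \<le> b * card V0" using c card_V0 by (intro mult_left_mono) auto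
  finally show "a \<le> b * card V0" .
qed

lemma I_subset_L:
  assumes T: "T \<subseteq> V0" "card T = c"
  shows "I \<subseteq> L {} T \<mu>"
  unfolding I_def L_def
proof (rule monomial_ideal_mono)
  fix e :: "nat \<Rightarrow> nat" assume e: "(\<forall>i\<in>V0. e i \<le> b) \<and> sum e V0 = a"
  have "sum e (V0 - T) \<le> (\<Sum>i\<in>V0 - T. b)" using e by (intro sum_mono) auto
  also have "\<dots> = b * (card V0 - c)"
    using card_Diff_subset[OF finite_sub[OF T(1)] T(1)] T(2) by (simp add: mult.commute)
  finally have "sum e (V0 - T) \<le> b * (card V0 - c)" .
  moreover have "sum e V0 = sum e (V0 - T) + sum e T" using T(1) fin by (rule sum.subset_diff)
  ultimately show "1 \<le> sum e {} \<or> \<mu> \<le> sum e T" using e a_eq by simp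
qed

lemma I_power_subset_L:
  assumes "T \<subseteq> V0" "card T = c"
  shows "ideal_power I m \<subseteq> L {} T (\<mu> * m)"
proof (induction m)
  case 0
  show ?case by (simp add: L_0)
next
  case (Suc m)
  have "x * y \<in> L {} T (\<mu> * Suc m)" if xy: "x \<in> ideal_power I m" "y \<in> I" for x y
  proof -
    have "x \<in> L {} T (\<mu> * m)" "y \<in> L {} T \<mu>" using xy Suc I_subset_L[OF assms] by auto
    from L_mult[OF this] show ?thesis by (simp add: add.commute)
  qed
  then show ?case unfolding ideal_power_Suc by (intro ideal_prod_subset) auto
qed

text \<open>Peel off one generator of \<open>I\<close> whose exponents are close to the average.\<close>

lemma mon_in_I_power:
  assumes "r * a \<le> (\<Sum>i\<in>V0. min (e i) (r * b))"
  shows "mon e \<in> ideal_power I r"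
  using assms
proof (induction r arbitrary: e)
  case 0
  then show ?case by (simp only: ideal_power_0 UNIV_I)
next
  case (Suc r)
  obtain e1 where e1: "\<And>i. i \<in> V0 \<Longrightarrow> 0 \<le> e1 i \<and> e1 i \<le> min (e i) (Suc r * b)" "sum e1 V0 = Suc r * a"
    by (rule exists_between_with_sum[OF fin, of "\<lambda>_. 0" "\<lambda>i. min (e i) (Suc r * b)" "Suc r * a"])
      (use Suc.prems in auto)
  have e1b: "e1 i \<le> b + r * b" "e1 i \<le> e i" if "i \<in> V0" for i using e1(1)[OF that] by auto
  \<comment> \<open>The generator g to be split off has to lie between e1 - r b, so that the rest
    respects the cap r b, and min b e1. Entrywise e1 / (r + 1) lies between these bounds and has sum
    a, so a value of sum exactly a fits.\<close>
  have "Suc r * (\<Sum>i\<in>V0. e1 i - r * b) \<le> Suc r * a"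
    unfolding sum_distrib_left e1(2)[symmetric]
  proof (rule sum_mono)
    fix i assume "i \<in> V0"
    then have "r * e1 i \<le> r * (b + r * b)" by (intro mult_left_mono e1b) auto
    then show "Suc r * (e1 i - r * b) \<le> e1 i"
      by (simp add: diff_mult_distrib2 algebra_simps)
  qed
  then have lo: "(\<Sum>i\<in>V0. e1 i - r * b) \<le> a" by (simp only: mult_le_cancel1)
  have "Suc r * a \<le> Suc r * (\<Sum>i\<in>V0. min b (e1 i))"
    unfolding sum_distrib_left e1(2)[symmetric]
  proof (rule sum_mono)
    fix i assume "i \<in> V0"
    then show "e1 i \<le> Suc r * min b (e1 i)" using e1b[of i] by (auto simp: min_def)
  qed
  then have hi: "a \<le> (\<Sum>i\<in>V0. min b (e1 i))" by (simp only: mult_le_cancel1)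
  obtain g where g: "\<And>i. i \<in> V0 \<Longrightarrow> e1 i - r * b \<le> g i \<and> g i \<le> min b (e1 i)" "sum g V0 = a"
    by (rule exists_between_with_sum[OF fin _ lo hi]) (use e1b in force)+
  have gle: "g i \<le> b" "g i \<le> e1 i" "e1 i - g i \<le> r * b" if "i \<in> V0" for i
    using g(1)[OF that] by auto
  have "mon (\<lambda>i. e i - g i) \<in> ideal_power I r"
  proof (rule Suc.IH)
    have "r * a = (\<Sum>i\<in>V0. e1 i - g i)"
      using e1(2) g(2) gle(2) by (simp add: sum_subtractf_nat)
    also have "\<dots> \<le> (\<Sum>i\<in>V0. min (e i - g i) (r * b))"
    proof (rule sum_mono)
      fix i assume i: "i \<in> V0"
      show "e1 i - g i \<le> min (e i - g i) (r * b)" using gle(3)[OF i] e1b(2)[OF i] by simp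
    qed
    finally show "r * a \<le> (\<Sum>i\<in>V0. min (e i - g i) (r * b))" .
  qed
  moreover have "mon g \<in> I" unfolding I_def
    using gle(1) g(2) by (intro monomial_in_monomial_ideal) auto
  ultimately have "mon (\<lambda>i. e i - g i) * mon g \<in> ideal_power I (Suc r)"
    unfolding ideal_power_Suc
    using ideal_prod.prod[of "mon (\<lambda>i. e i - g i)" "ideal_power I r" "mon g" I ring_of_type_algebra]
    by simp
  moreover have "mon (\<lambda>i. e i - g i) * mon g = mon e"
    unfolding monomial_add[symmetric] unfolding monomial_def
    using le_trans[OF gle(2) e1b(2)] by (intro prod.cong) auto
  ultimately show ?case by simp
qed

text \<open>\<open>H\<close> collects the indices where the cap r b is reached. If fewer than c
  indices remain, then |H| \<ge> s - c + 1 and the caps alone supply r a; otherwise the averaging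
  bound applies to the remaining indices.\<close>

lemma exponents_sufficient:
  assumes e: "\<And>T. T \<subseteq> V0 \<Longrightarrow> card T = c \<Longrightarrow> \<mu> * m \<le> sum e T"
    and r: "r * a * c \<le> \<mu> * m * card V0"
  shows "r * a \<le> (\<Sum>i\<in>V0. min (e i) (r * b))"
proof -
  let ?s = "card V0"
  define H where "H = {i \<in> V0. r * b \<le> e i}"
  define E where "E = V0 - H"
  have HE: "finite H" "finite E" "H \<subseteq> V0" "E \<subseteq> V0" using fin by (auto simp: H_def E_def)
  have cards: "?s = card H + card E"
    unfolding E_def using HE fin by (simp add: card_Diff_subset card_mono)
  have "(\<Sum>i\<in>V0. min (e i) (r * b)) = (\<Sum>i\<in>E. min (e i) (r * b)) + (\<Sum>i\<in>H. min (e i) (r * b))"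
    unfolding E_def using HE(3) fin by (rule sum.subset_diff)
  also have "(\<Sum>i\<in>H. min (e i) (r * b)) = (\<Sum>i\<in>H. r * b)"
    by (rule sum.cong) (auto simp: H_def)
  also have "(\<Sum>i\<in>E. min (e i) (r * b)) = sum e E"
    by (rule sum.cong) (auto simp: E_def H_def)
  finally have S: "(\<Sum>i\<in>V0. min (e i) (r * b)) = sum e E + card H * (r * b)" by simp
  show ?thesis
  proof (cases "card E < c")
    case True
    then have "?s - c + 1 \<le> card H" using cards c card_V0 by simp
    then have "(?s - c + 1) * (r * b) \<le> card H * (r * b)" by (rule mult_right_mono) simp
    moreover have "r * a \<le> r * (b * (?s - c + 1))" using a_le(1) by (rule mult_left_mono) simp
    ultimately show ?thesis unfolding S by (simp add: algebra_simps)
  next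
    case False
    \<comment> \<open>After scaling by c s, the share |E| of r a is covered by averaging over E
      together with the bound on r, and the share |H| by a \<le> b s.\<close>
    have "card E * (\<mu> * m) \<le> c * sum e E"
      by (rule card_mult_le_if_subset_sums_ge[OF HE(2) c(1)]) (use False HE(4) e in auto)
    then have "?s * (card E * (\<mu> * m)) \<le> ?s * (c * sum e E)" by (rule mult_left_mono) simp
    moreover have "card E * (r * a * c) \<le> card E * (\<mu> * m * ?s)" using r by (rule mult_left_mono) simp
    moreover have "c * card H * r * a \<le> c * card H * r * (b * ?s)"
      using a_le(2) by (rule mult_left_mono) simp
    ultimately have "(c * ?s) * (r * a) \<le> (c * ?s) * (sum e E + card H * (r * b))"
      unfolding cards by (simp add: algebra_simps)
    moreover have "c * ?s > 0" using c card_V0 by simp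
    ultimately show ?thesis unfolding S by (simp only: mult_le_cancel1)
  qed
qed

text \<open>If p contained fewer than c of the f_i, the other s - c + 1 or more could share the
  exponent a with entries at most b, giving a generator of I outside p.\<close>

lemma prime_over_I:
  assumes p: "primeideal p ring_of_type_algebra" "I \<subseteq> p"
  shows "c \<le> card {i \<in> V0. f i \<in> p}"
proof (rule ccontr)
  define Z where "Z = {i \<in> V0. f i \<in> p}"
  assume "\<not> ?thesis"
  then have Z: "card Z < c" "Z \<subseteq> V0" "finite Z" using fin by (auto simp: Z_def)
  then have "card V0 - c + 1 \<le> card (V0 - Z)" using c card_V0 by (simp add: card_Diff_subset)
  then have "b * (card V0 - c + 1) \<le> b * card (V0 - Z)" by (rule mult_left_mono) simp
  then have "a \<le> (\<Sum>i\<in>V0 - Z. b)" using a_le(1) by (simp add: mult.commute)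
  then obtain g where g: "\<And>i. i \<in> V0 - Z \<Longrightarrow> 0 \<le> g i \<and> g i \<le> b" "sum g (V0 - Z) = a"
    by (rule exists_between_with_sum[of "V0 - Z" "\<lambda>_. 0" "\<lambda>_. b" a, rotated 3]) (use fin in auto)
  define e where "e = (\<lambda>i. if i \<in> Z then 0 else g i)"
  have "sum e V0 = sum e (V0 - Z) + sum e Z" using Z(2) fin by (rule sum.subset_diff)
  also have "\<dots> = a" using g(2) by (simp add: e_def)
  finally have "mon e \<in> I" unfolding I_def
    using g(1) by (intro monomial_in_monomial_ideal) (auto simp: e_def)
  then obtain i where "i \<in> V0" "e i > 0" "f i \<in> p"
    using prime_contains_factor[OF p(1) fin] p(2) by blast
  then show False by (auto simp: e_def Z_def)
qed

lemma form_nonzerodivisor: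
  assumes "T \<subseteq> V0" "card T = c" "j \<in> V0 - T"
  shows "f j \<in> nonzerodivisors (L {} T k)"
  using colon_notin[of "{}" T j _ k] assms c by (simp add: nonzerodivisors_def)

text \<open>If g is not in Q, the colon ideal (Q : g) contains no nonzerodivisor modulo Q and
  extends to a prime p with the same property. Of the f_i, such a p contains only those in T, so
  each prime q between I and p contains exactly these. An element of p outside q would put into p a
  nonzero polynomial in the remaining forms, which is a nonzerodivisor. Hence p is minimal over I,
  and u g \<in> I^m with u outside p contradicts (Q : g) \<subseteq> p.\<close>

lemma symbolic_power_subset_L:
  assumes T: "T \<subseteq> V0" "card T = c" and m: "m > 0"
  shows "symbolic_power I m \<subseteq> L {} T (\<mu> * m)"
proof
  fix g assume g: "g \<in> symbolic_power I m"
  let ?Q = "L {} T (\<mu> * m)"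
  have \<mu>m: "\<mu> * m > 0" using m \<mu> by simp
  have finT: "finite T" using T finite_sub by auto
  show "g \<in> ?Q"
  proof (rule ccontr)
    assume gQ: "g \<notin> ?Q"
    define J where "J = {u. u * g \<in> ?Q}"
    have "ideals.subspace J"
    proof (rule ideals.subspaceI)
      show "0 \<in> J" by (simp add: J_def ideals.subspace_0)
      show "x + y \<in> J" if "x \<in> J" "y \<in> J" for x y
        using ideals.subspace_add[OF subspace_L] that by (simp add: J_def distrib_right)
      show "t * x \<in> J" if "x \<in> J" for t x
        using ideals.subspace_scale[OF subspace_L] that by (simp add: J_def mult.assoc)
    qed
    moreover have "J \<inter> nonzerodivisors ?Q = {}" using gQ by (auto simp: J_def nonzerodivisors_def)
    ultimately obtain p where p: "primeideal p ring_of_type_algebra" "J \<subseteq> p"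
      "p \<inter> nonzerodivisors ?Q = {}"
      using exists_prime_disjoint[OF _ _ nonzerodivisors_1 nonzerodivisors_mult] by blast
    have pI: "ideals.subspace p" using p(1) by (simp add: primeideal_iff)
    have Qp: "?Q \<subseteq> p"
    proof
      fix x assume "x \<in> ?Q"
      then have "g * x \<in> ?Q" by (rule ideals.subspace_scale[OF subspace_L])
      then show "x \<in> p" using p(2) by (auto simp: J_def mult.commute)
    qed
    have Tp: "f ` T \<subseteq> p"
    proof
      fix x assume "x \<in> f ` T"
      then obtain i where i: "i \<in> T" "x = f i" by auto
      define e where "e = (\<lambda>j. if j = i then \<mu> * m else 0)"
      have "sum e T = \<mu> * m" using i finT by (simp add: e_def)
      then have "mon e \<in> p" using Qp
        by (intro subsetD[OF Qp]) (auto simp: L_def intro: monomial_in_monomial_ideal)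
      then obtain j where "j \<in> V0" "e j > 0" "f j \<in> p"
        using prime_contains_factor[OF p(1) fin] by blast
      then show "x \<in> p" using i by (auto simp: e_def split: if_splits)
    qed
    have Ip: "I \<subseteq> p"
      using I_subset_L[OF T] L_subset_prime[OF p(1) Tp T(1), of \<mu>] \<mu> by auto
    have Zp: "{i \<in> V0. f i \<in> p} \<subseteq> T"
      using form_nonzerodivisor[OF T, of _ "\<mu> * m"] p(3) by blast
    have "p \<in> minimal_primes I"
      unfolding minimal_primes_def
    proof (intro CollectI conjI allI impI)
      fix q assume q: "primeideal q ring_of_type_algebra \<and> I \<subseteq> q \<and> q \<subseteq> p"
      have "{i \<in> V0. f i \<in> q} \<subseteq> T" using q Zp by auto
      then have "{i \<in> V0. f i \<in> q} = T"
        using prime_over_I[of q] q T finT by (intro card_seteq) auto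
      then have Tq: "f ` T \<subseteq> q" by auto
      \<comment> \<open>Together with T this makes as many forms as variables: enough for the
        algebraic relation with x, and still few enough for regularity.\<close>
      obtain W where W: "W \<subseteq> V0 - T" "card W = CARD('v) - c" "finite W"
        by (rule obtain_subset_with_card_n[of "CARD('v) - c" "V0 - T"])
          (use T finT card_V0 in \<open>auto simp: card_Diff_subset\<close>)
      have "p \<subseteq> q"
      proof (rule ccontr)
        assume "\<not> p \<subseteq> q"
        then obtain x where x: "x \<in> p" "x \<notin> q" by auto
        have W': "W \<subseteq> V0" "T \<inter> W = {}" "card T + card W = CARD('v)" using W T c by auto
        obtain B k where B: "finite B" "B \<noteq> {}" "\<And>e. e \<in> B \<Longrightarrow> \<forall>j. j \<notin> W \<longrightarrow> e j = 0"
          "\<And>e. e \<in> B \<Longrightarrow> k e \<noteq> 0" "(\<Sum>e\<in>B. const_poly (k e) * monomial W f e) \<in> p"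
          by (rule prime_over_contains_polynomial[OF T(1) W' conjunct1[OF q] Tq pI _ x]) (use q in auto)
        have "(\<Sum>e\<in>B. const_poly (k e) * monomial W f e) \<in> nonzerodivisors ?Q"
          unfolding nonzerodivisors_def
        proof (intro CollectI allI impI)
          fix y assume "(\<Sum>e\<in>B. const_poly (k e) * monomial W f e) * y \<in> ?Q"
          then show "y \<in> ?Q"
            by (rule nonzero_polynomial_nonzerodivisor[rotated -1, where W = W and U = "{}" and B = B and c = k])
              (use W W' B T in auto)
        qed
        then show False using B(5) p(3) by blast
      qed
      then show "q = p" using q by auto
    qed (use p Ip in auto)
    then have "g \<in> local_contraction p (ideal_power I m)"
      using g by (auto simp: symbolic_power_def)
    then obtain u where u: "u \<notin> p" "u * g \<in> ideal_power I m"
      unfolding local_contraction_eq[OF p(1) subspace_I_power] by auto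
    then have "u * g \<in> ?Q" using I_power_subset_L[OF T] by auto
    then show False using u(1) p(2) by (auto simp: J_def)
  qed
qed

theorem symbolic_power_subset_power:
  assumes "m > 0" "r * a * c \<le> \<mu> * m * card V0"
  shows "symbolic_power I m \<subseteq> ideal_power I r"
proof
  fix g assume g: "g \<in> symbolic_power I m"
  have "g \<in> MI (\<lambda>e. 1 \<le> sum e {} \<or>
      (\<forall>T\<subseteq>V0. card T = c \<longrightarrow> \<mu> * m \<le> sum e T + sum (\<lambda>_. 0) T))"
  proof (rule Inter_L_subset_monomial_ideal)
    fix T assume "T \<subseteq> V0" "card T = c"
    then show "g \<in> L {} T (\<mu> * m - sum (\<lambda>_. 0) T)"
      using symbolic_power_subset_L[OF _ _ assms(1)] g by auto
  qed (use c in auto)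
  also have "\<dots> \<subseteq> ideal_power I r"
  proof (rule monomial_ideal_subset[OF subspace_I_power])
    fix e :: "nat \<Rightarrow> nat"
    assume "1 \<le> sum e {} \<or> (\<forall>T\<subseteq>V0. card T = c \<longrightarrow> \<mu> * m \<le> sum e T + sum (\<lambda>_. 0) T)"
    then show "mon e \<in> ideal_power I r"
      by (intro mon_in_I_power exponents_sufficient[OF _ assms(2)]) auto
  qed
  finally show "g \<in> ideal_power I r" .
qed

text \<open>If p contained a further f_j besides some f_i with i \<in> T, |T| = c, a prime q over
  (f_i : i \<in> T) avoiding all products of an element outside p with a nonzerodivisor would lie
  over I and inside p, yet miss f_j, against minimality.\<close>

lemma minimal_prime_card:
  assumes p: "p \<in> minimal_primes I"
  shows "card {i \<in> V0. f i \<in> p} = c"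
proof (rule ccontr)
  define Z where "Z = {i \<in> V0. f i \<in> p}"
  assume neq: "card {i \<in> V0. f i \<in> p} \<noteq> c"
  have pp: "primeideal p ring_of_type_algebra" "I \<subseteq> p"
    and min: "\<And>q. primeideal q ring_of_type_algebra \<Longrightarrow> I \<subseteq> q \<Longrightarrow> q \<subseteq> p \<Longrightarrow> q = p"
    using p by (auto simp: minimal_primes_def)
  have Z: "c < card Z" "finite Z" "Z \<subseteq> V0" using prime_over_I[OF pp] neq fin by (auto simp: Z_def)
  obtain T where T: "T \<subseteq> Z" "card T = c" "finite T"
    using obtain_subset_with_card_n[of c Z] Z(1) by auto
  obtain j where j: "j \<in> Z" "j \<notin> T" using Z T by (metis less_irrefl subsetI subset_antisym)
  have TV: "T \<subseteq> V0" using T Z by auto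
  let ?Q = "L {} T 1"
  define M where "M = {u * v | u v. u \<notin> p \<and> v \<in> nonzerodivisors ?Q}"
  have Qp: "?Q \<subseteq> p" by (rule L_subset_prime[OF pp(1) _ TV]) (use T in \<open>auto simp: Z_def\<close>)
  have "?Q \<inter> M = {}"
  proof (rule ccontr)
    assume "?Q \<inter> M \<noteq> {}"
    then obtain u v where "u * v \<in> ?Q" "u \<notin> p" "v \<in> nonzerodivisors ?Q"
      by (auto simp: M_def)
    then show False using Qp by (auto simp: nonzerodivisors_def mult.commute)
  qed
  moreover have p1: "1 \<notin> p" using pp(1) by (simp add: primeideal_iff)
  note one = nonzerodivisors_1[of ?Q]
  have "1 * 1 \<in> M" unfolding M_def using p1 one by blast
  then have "1 \<in> M" by simp
  moreover have "x * y \<in> M" if xy: "x \<in> M" "y \<in> M" for x y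
  proof -
    obtain u v u' v' where uv: "x = u * v" "u \<notin> p" "v \<in> nonzerodivisors ?Q"
      "y = u' * v'" "u' \<notin> p" "v' \<in> nonzerodivisors ?Q"
      using xy by (auto simp: M_def)
    have "x * y = (u * u') * (v * v')" using uv by (simp add: mult_ac)
    moreover have "u * u' \<notin> p" using uv pp(1) by (auto simp: primeideal_iff)
    moreover have "v * v' \<in> nonzerodivisors ?Q" using uv(3,6) by (rule nonzerodivisors_mult)
    ultimately show ?thesis unfolding M_def by blast
  qed
  ultimately obtain q where q: "primeideal q ring_of_type_algebra" "?Q \<subseteq> q" "q \<inter> M = {}"
    by (rule exists_prime_disjoint[OF subspace_L])
  have "q \<subseteq> p"
  proof
    fix x assume "x \<in> q"
    then have "x \<notin> M" using q(3) by auto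
    then have "\<not> x * 1 \<in> M" by simp
    then show "x \<in> p" unfolding M_def using one by blast
  qed
  moreover have "I \<subseteq> q" using I_subset_L[OF TV T(2)] L_anti[of 1 \<mu> "{}" T] \<mu>(1) q(2) by auto
  ultimately have "q = p" using min q(1) by auto
  then have "f j \<in> q" using j by (auto simp: Z_def)
  moreover have "1 * f j \<in> M" unfolding M_def
    using p1 form_nonzerodivisor[OF TV T(2), of j 1] j Z by blast
  ultimately show False using q(3) by auto
qed

text \<open>Locally at p the f_i outside p are units, so their exponents may be raised to the cap m
  b. They contribute (s - c) m b, and the c factors in p only have to supply \<mu> m.\<close>

lemma product_power_in_symbolic_power:
  assumes "\<mu> * m \<le> c * j"
  shows "mon (\<lambda>_. j) \<in> symbolic_power I m"
  unfolding symbolic_power_def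
proof
  fix p assume p: "p \<in> minimal_primes I"
  then have pp: "primeideal p ring_of_type_algebra" by (simp add: minimal_primes_def)
  define Z where "Z = {i \<in> V0. f i \<in> p}"
  have Z: "card Z = c" "Z \<subseteq> V0" using minimal_prime_card[OF p] by (auto simp: Z_def)
  define e where "e = (\<lambda>i. if i \<in> Z then 0 else m * b)"
  have "mon e \<notin> p"
  proof
    assume "mon e \<in> p"
    then obtain i where "i \<in> V0" "e i > 0" "f i \<in> p"
      using prime_contains_factor[OF pp fin] by blast
    then show False by (auto simp: e_def Z_def)
  qed
  moreover have "mon (\<lambda>i. e i + j) \<in> ideal_power I m"
  proof (rule mon_in_I_power)
    have "\<mu> * m \<le> c * (m * b)"
    proof -
      have "\<mu> * m \<le> b * m" using \<mu>(2) by (rule mult_right_mono) simp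
      also have "\<dots> \<le> c * (b * m)" using c(1) by simp
      finally show ?thesis by (simp add: mult.commute)
    qed
    then have "\<mu> * m \<le> c * min j (m * b)" using assms by (simp add: min_def)
    moreover have "(\<Sum>i\<in>V0. min (e i + j) (m * b)) =
        (\<Sum>i\<in>V0 - Z. min (e i + j) (m * b)) + (\<Sum>i\<in>Z. min (e i + j) (m * b))"
      using Z(2) fin by (rule sum.subset_diff)
    moreover have "(\<Sum>i\<in>Z. min (e i + j) (m * b)) = c * min j (m * b)" using Z(1) by (simp add: e_def)
    moreover have "(\<Sum>i\<in>V0 - Z. min (e i + j) (m * b)) = (\<Sum>i\<in>V0 - Z. m * b)"
      by (rule sum.cong) (auto simp: e_def)
    moreover have "\<dots> = (card V0 - c) * (m * b)" using Z finite_sub[OF Z(2)] by (simp add: card_Diff_subset)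
    ultimately show "m * a \<le> (\<Sum>i\<in>V0. min (e i + j) (m * b))"
      unfolding a_eq by (simp add: algebra_simps)
  qed
  then have "mon e * mon (\<lambda>_. j) \<in> ideal_power I m" by (simp only: monomial_add)
  ultimately show "mon (\<lambda>_. j) \<in> local_contraction p (ideal_power I m)"
    unfolding local_contraction_eq[OF pp subspace_I_power] by blast
qed

end

section \<open>Genericity, initial degrees and resurgence\<close>

text \<open>If \<open>x\<close> is regular modulo \<open>W\<close> and \<open>z\<close> modulo \<open>W \<union> {x}\<close> and modulo \<open>W\<close>, then \<open>x\<close> is regular
  modulo \<open>W \<union> {z}\<close>; so regularity of all subsets in some order gives it in every order.\<close>

lemma nonzerodivisor_if_subsets_regular:
  fixes G :: "'a::comm_ring_1 set"
  assumes "finite G" "\<And>H. H \<subseteq> G \<Longrightarrow> forms_regular_sequence H" "x \<in> G"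
    and "x * y \<in> ideals.span (G - {x})"
  shows "y \<in> ideals.span (G - {x})"
  using assms
proof (induction "card G" arbitrary: G x y rule: less_induct)
  case less
  obtain xs where xs: "distinct xs" "set xs = G" "regular_sequence xs"
    using less.prems(2)[of G] by (auto simp: forms_regular_sequence_def)
  have "xs \<noteq> []" using xs(2) less.prems(3) by auto
  \<comment> \<open>The last entry of a regular ordering is regular modulo all the others; the
    remaining cases come from smaller sets.\<close>
  then obtain ys z where ys: "xs = ys @ [z]" by (cases xs rule: rev_cases) auto
  have Gz: "set ys = G - {z}" using xs(1,2) ys by auto
  have zG: "z \<in> G" using xs(2) ys by auto
  have z: "v \<in> ideals.span (G - {z})" if v: "z * v \<in> ideals.span (G - {z})" for v
  proof -
    have "\<forall>g. xs ! length ys * g \<in> ideal_gen (set (take (length ys) xs))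
        \<longrightarrow> g \<in> ideal_gen (set (take (length ys) xs))"
      using xs(3) unfolding regular_sequence_def ys by auto
    then show ?thesis using v unfolding ideal_gen_eq_span ys by (simp add: Gz)
  qed
  show ?case
  proof (cases "x = z")
    case True
    then show ?thesis using z less.prems(4) by simp
  next
    case False
    define W where "W = G - {x, z}"
    have W: "G - {x} = insert z W" "G - {z} = insert x W" "G - {x} - {z} = W" "G - {z} - {x} = W"
      using False zG less.prems(3) by (auto simp: W_def)
    have card: "card (G - {t}) < card G" if "t \<in> G" for t
      using less.prems(1) that by (rule card_Diff1_less)
    have xW: "v \<in> ideals.span W" if "x * v \<in> ideals.span W" for v
    proof -
      have "v \<in> ideals.span (G - {z} - {x})"
        by (rule less.hyps[of "G - {z}" x v, OF card[OF zG]])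
          (use less.prems(1-3) that False in \<open>auto simp only: W(4) finite_Diff\<close>)
      then show ?thesis unfolding W(4) .
    qed
    have zW: "v \<in> ideals.span W" if "z * v \<in> ideals.span W" for v
    proof -
      have "v \<in> ideals.span (G - {x} - {z})"
        by (rule less.hyps[of "G - {x}" z v, OF card[OF less.prems(3)]])
          (use less.prems(1,2) zG that False in \<open>auto simp only: W(3) finite_Diff\<close>)
      then show ?thesis unfolding W(3) .
    qed
    obtain v where v: "x * y - v * z \<in> ideals.span W"
      using less.prems(4) unfolding W ideals.span_insert by auto
    have Wx: "ideals.span W \<subseteq> ideals.span (insert x W)" by (rule ideals.span_mono) auto
    have "z * v = y * x - (x * y - v * z)" by (simp add: algebra_simps)
    also have "\<dots> \<in> ideals.span (insert x W)"
      by (rule ideals.span_diff[OF ideals.span_scale[OF ideals.span_base] subsetD[OF Wx v]]) simp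
    finally have "v \<in> ideals.span (insert x W)" using z unfolding W by simp
    then obtain k where k: "v - k * x \<in> ideals.span W" unfolding ideals.span_insert by auto
    have "x * (y - k * z) = (x * y - v * z) + z * (v - k * x)" by (simp add: algebra_simps)
    also have "\<dots> \<in> ideals.span W" by (rule ideals.span_add[OF v ideals.span_scale[OF k]])
    finally have "y - k * z \<in> ideals.span W" by (rule xW)
    then show ?thesis unfolding W ideals.span_insert by auto
  qed
qed

lemma generic_family_if_generic_forms:
  fixes f :: "nat \<Rightarrow> ('v::{finite,linorder}, 'k::field) mpolyn"
  assumes "finite V" "V \<noteq> {}" "inj_on f V" "generic_forms (f ` V)" "\<And>i. i \<in> V \<Longrightarrow> form_of_degree d (f i)"
  shows "generic_family V f d"
proof (unfold_locales)
  show "finite V" by fact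
  show "0 < d" using assms(2,5) by (auto simp: form_of_degree_def)
  show "homogeneous_of_degree d (f i)" if "i \<in> V" for i
    using assms(5)[OF that] by (simp add: form_of_degree_def)
next
  fix U i x
  assume U: "U \<subseteq> V" "card U < CARD('v)" and i: "i \<in> V" "i \<notin> U"
    and x: "f i * x \<in> ideals.span (f ` U)"
  have finU: "finite U" using U(1) assms(1) by (rule finite_subset)
  \<comment> \<open>Injectivity turns regularity of a set of forms into a statement about
    indices.\<close>
  have eq: "f ` insert i U - {f i} = f ` U"
    using inj_on_image_set_diff[OF assms(3), of "insert i U" "{i}"] U i by auto
  have "x \<in> ideals.span (f ` insert i U - {f i})"
  proof (rule nonzerodivisor_if_subsets_regular)
    fix H assume H: "H \<subseteq> f ` insert i U"
    have "card (f ` insert i U) \<le> CARD('v)"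
      using card_image_le[of "insert i U" f] finU i U by simp
    then have "card H \<le> CARD('v)" using card_mono[OF _ H] finU by simp
    moreover have "H \<subseteq> f ` V" using H U i by auto
    ultimately show "forms_regular_sequence H"
      using assms(4) finite_subset[OF H] finU by (simp add: generic_forms_def)
  next
    show "f i * x \<in> ideals.span (f ` insert i U - {f i})" unfolding eq by (rule x)
  qed (use finU in auto)
  then show "x \<in> ideals.span (f ` U)" unfolding eq .
qed

section \<open>Initial degrees, their limit, and the resurgence\<close>

context fold_ideal
begin

lemma mon_nonzero: "mon e \<noteq> 0"
proof -
  have "f i \<noteq> 0" if "i \<in> V0" for i
    using reg[of "{}" i 1] that by auto
  then show ?thesis using fin by (simp add: monomial_def)
qed

text \<open>For T = V0 the exponent sum of a monomial is its degree divided by d, so membership in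
  I^r becomes a degree bound.\<close>

lemma I_power_subset_L_total: "ideal_power I r \<subseteq> L {} V0 (r * a)"
proof (induction r)
  case 0
  show ?case by (simp add: L_0)
next
  case (Suc r)
  have "I \<subseteq> L {} V0 a" unfolding I_def L_def by (rule monomial_ideal_mono) auto
  then have "x * y \<in> L {} V0 (Suc r * a)" if "x \<in> ideal_power I r" "y \<in> I" for x y
    using L_mult[of x V0 "r * a" y a] that Suc by (auto simp: add.commute)
  then show ?case unfolding ideal_power_Suc by (intro ideal_prod_subset) auto
qed

lemma degree_ge_if_mem_I_power:
  assumes "g \<in> ideal_power I r" "g \<noteq> 0" "homogeneous_of_degree D g"
  shows "d * (r * a) \<le> D"
proof (rule ccontr)
  assume D: "\<not> ?thesis"
  have g: "g \<in> ideals.span {mon e | e. 1 \<le> sum e {} \<or> r * a \<le> sum e V0}"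
    using assms(1) I_power_subset_L_total unfolding L_def monomial_ideal_def by blast
  have "truncate D g = 0"
  proof (rule truncate_span_eq_0[OF _ g])
    fix m assume "m \<in> {mon e | e. 1 \<le> sum e {} \<or> r * a \<le> sum e V0}"
    then obtain e where e: "m = mon e" "r * a \<le> sum e V0" by auto
    then have "d * (r * a) \<le> d * sum e V0" by (intro mult_left_mono) auto
    then have "D < d * sum e V0" using D by linarith
    then show "\<exists>t>D. homogeneous_of_degree t m" using homogeneous_mon[of e] unfolding e(1) by blast
  qed
  moreover have "truncate D g = g"
    using assms(3) by (intro truncate_eq_self) (auto simp: homogeneous_iff_total_degree)
  ultimately show False using assms(2) by simp
qed

lemma a_pos: "a > 0" and card_V0_pos: "card V0 > 0"
  using a_eq \<mu> c card_V0 by auto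

lemma ideal_power_1: "ideal_power I 1 = I"
proof -
  have "ideal_prod ring_of_type_algebra UNIV I \<subseteq> I"
    by (rule ideal_prod_subset) (auto intro: ideals.subspace_scale)
  moreover have "x \<in> ideal_prod ring_of_type_algebra UNIV I" if "x \<in> I" for x
    using ideal_prod.prod[of 1 UNIV x I ring_of_type_algebra] that by simp
  ultimately show ?thesis
    using ideal_power_Suc[of I 0] unfolding ideal_power_0 by auto
qed

lemma initial_degree_I: "initial_degree I = d * a"
  unfolding initial_degree_def
proof (rule Least_equality)
  obtain e where e: "\<And>i. i \<in> V0 \<Longrightarrow> 0 \<le> e i \<and> e i \<le> b" "sum e V0 = a"
    by (rule exists_between_with_sum[OF fin, of "\<lambda>_. 0" "\<lambda>_. b" a])
      (use a_le(2) in \<open>auto simp: mult.commute\<close>)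
  then have "mon e \<in> I" unfolding I_def by (intro monomial_in_monomial_ideal) auto
  moreover have "form_of_degree (d * a) (mon e)"
    using homogeneous_mon[of e] d_pos a_pos by (simp add: form_of_degree_def e(2))
  ultimately show "\<exists>p\<in>I. p \<noteq> 0 \<and> form_of_degree (d * a) p" using mon_nonzero by blast
next
  fix D assume "\<exists>p\<in>I. p \<noteq> 0 \<and> form_of_degree D p"
  then show "d * a \<le> D"
    using degree_ge_if_mem_I_power[of _ 1 D] unfolding ideal_power_1 form_of_degree_def by auto
qed

lemma form_product_power: "j > 0 \<Longrightarrow> form_of_degree (d * (card V0 * j)) (mon (\<lambda>_. j))"
  using homogeneous_mon[of "\<lambda>_. j"] d_pos card_V0_pos by (simp add: form_of_degree_def)

lemma initial_degree_symbolic_power_le: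
  assumes "\<mu> * m \<le> c * j" "j > 0"
  shows "initial_degree (symbolic_power I m) \<le> d * (card V0 * j)"
  unfolding initial_degree_def
  by (rule Least_le)
    (use product_power_in_symbolic_power[OF assms(1)] form_product_power[OF assms(2)] mon_nonzero in blast)

lemma initial_degree_symbolic_power_ge:
  assumes "m > 0" "r * a * c \<le> \<mu> * m * card V0"
  shows "d * (r * a) \<le> initial_degree (symbolic_power I m)"
proof -
  \<comment> \<open>\<open>LEAST\<close> is meaningful only if some form exists; the product of all
    f_i raised to \<mu> m is a crude witness.\<close>
  have "\<mu> * m \<le> c * (\<mu> * m)" "\<mu> * m > 0" using c \<mu> assms(1) by auto
  then have "\<exists>p\<in>symbolic_power I m. p \<noteq> 0 \<and> form_of_degree (d * (card V0 * (\<mu> * m))) p"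
    using product_power_in_symbolic_power form_product_power mon_nonzero by blast
  then have "\<exists>p\<in>symbolic_power I m. p \<noteq> 0 \<and> form_of_degree (initial_degree (symbolic_power I m)) p"
    unfolding initial_degree_def by (rule LeastI)
  then show ?thesis
    using degree_ge_if_mem_I_power symbolic_power_subset_power[OF assms]
    unfolding form_of_degree_def by blast
qed

text \<open>Both degree bounds are exact up to rounding j upwards and r downwards to integers, an
  error of at most d s above and d a below, which vanishes after division by m.\<close>

lemma asymptotic_initial_degree_I:
  "asymptotic_initial_degree I = real d * real \<mu> * real (card V0) / real c"
proof -
  let ?s = "card V0" and ?\<alpha> = "\<lambda>m. real (initial_degree (symbolic_power I m))"
  let ?K = "real d * real \<mu> * real ?s / real c"
  have cpos: "real c > 0" and apos: "real a > 0" using c a_pos by auto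
  have upper: "?\<alpha> m / real m \<le> ?K + real (d * ?s) / real m" if m: "m > 0" for m
  proof -
    define j where "j = \<mu> * m div c + 1"
    have "\<mu> * m \<le> c * j" unfolding j_def using c
      by (metis Suc_eq_plus1 dividend_less_times_div less_imp_le mult_Suc_right add.commute not_one_le_zero zero_less_iff_neq_zero)
    then have "initial_degree (symbolic_power I m) \<le> d * (?s * j)"
      by (rule initial_degree_symbolic_power_le) (simp add: j_def)
    then have "?\<alpha> m \<le> real (d * (?s * j))" by (simp only: of_nat_le_iff)
    also have "\<dots> = real (d * ?s) * real j" by simp
    also have "real j \<le> real (\<mu> * m) / real c + 1"
      unfolding j_def using of_nat_div_le_of_nat[of "\<mu> * m" c, where 'a = real] by simp
    then have "real (d * ?s) * real j \<le> real (d * ?s) * (real (\<mu> * m) / real c + 1)"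
      by (rule mult_left_mono) simp
    finally have "?\<alpha> m / real m \<le> real (d * ?s) * (real (\<mu> * m) / real c + 1) / real m"
      by (rule divide_right_mono) simp
    also have "\<dots> = ?K + real (d * ?s) / real m"
      using m by (simp add: distrib_left add_divide_distrib)
    finally show ?thesis .
  qed
  have lower: "?K - real (d * a) / real m \<le> ?\<alpha> m / real m" if m: "m > 0" for m
  proof -
    define r where "r = \<mu> * m * ?s div (a * c)"
    have "r * a * c \<le> \<mu> * m * ?s"
      unfolding r_def mult.assoc[of _ a c] by (rule div_times_less_eq_dividend)
    then have "d * (r * a) \<le> initial_degree (symbolic_power I m)"
      by (rule initial_degree_symbolic_power_ge[OF m])
    then have "real (d * (r * a)) \<le> ?\<alpha> m" by (simp only: of_nat_le_iff)
    moreover have "real (\<mu> * m * ?s) / real (a * c) - 1 \<le> real r"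
    proof -
      have "\<mu> * m * ?s < a * c * r + a * c"
        unfolding r_def using dividend_less_times_div[of "a * c" "\<mu> * m * ?s"] c a_pos by simp
      then have "real (\<mu> * m * ?s) \<le> real (a * c * r + a * c)" by (simp only: of_nat_le_iff)
      also have "\<dots> = (real r + 1) * real (a * c)" by (simp add: algebra_simps)
      finally have "real (\<mu> * m * ?s) / real (a * c) \<le> real r + 1"
        using cpos apos by (subst pos_divide_le_eq) simp_all
      then show ?thesis by simp
    qed
    then have "real (d * a) * (real (\<mu> * m * ?s) / real (a * c) - 1) \<le> real (d * a) * real r"
      by (rule mult_left_mono) simp
    ultimately have "real (d * a) * (real (\<mu> * m * ?s) / real (a * c) - 1) \<le> ?\<alpha> m"
      by (simp add: mult_ac)
    moreover have "real (d * a) * (real (\<mu> * m * ?s) / real (a * c) - 1) =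
        ?K * real m - real (d * a)"
      using cpos apos by (simp add: right_diff_distrib mult_ac)
    ultimately have "(?K * real m - real (d * a)) / real m \<le> ?\<alpha> m / real m"
      by (intro divide_right_mono) auto
    then show ?thesis using m by (simp add: diff_divide_distrib)
  qed
  have "(\<lambda>m. ?\<alpha> m / real m) \<longlonglongrightarrow> ?K"
  proof (rule tendsto_sandwich)
    show "\<forall>\<^sub>F m in sequentially. ?K - real (d * a) / real m \<le> ?\<alpha> m / real m"
      using eventually_gt_at_top[of 0] by eventually_elim (rule lower)
    show "\<forall>\<^sub>F m in sequentially. ?\<alpha> m / real m \<le> ?K + real (d * ?s) / real m"
      using eventually_gt_at_top[of 0] by eventually_elim (rule upper)
    show "(\<lambda>m. ?K - real (d * a) / real m) \<longlonglongrightarrow> ?K"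
      using tendsto_diff[OF tendsto_const lim_const_over_n] by (metis (no_types) diff_zero)
    show "(\<lambda>m. ?K + real (d * ?s) / real m) \<longlonglongrightarrow> ?K"
      using tendsto_add[OF tendsto_const lim_const_over_n] by (metis (no_types) add.right_neutral)
  qed
  then show ?thesis unfolding asymptotic_initial_degree_def by (rule limI)
qed

lemma resurgence_I: "resurgence I = ereal (real a * real c / (real \<mu> * real (card V0)))"
proof -
  let ?s = "card V0"
  let ?\<rho> = "real a * real c / (real \<mu> * real ?s)"
  let ?A = "{ereal (real m / real r) | m r.
    m > 0 \<and> r > 0 \<and> \<not> symbolic_power I m \<subseteq> ideal_power I r}"
  have pos: "real \<mu> > 0" "real ?s > 0" using \<mu> card_V0_pos by auto
  have "Sup ?A \<le> ereal ?\<rho>"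
  proof (rule Sup_least)
    fix t assume "t \<in> ?A"
    then obtain m r where t: "t = ereal (real m / real r)" "m > 0" "r > 0"
      "\<not> symbolic_power I m \<subseteq> ideal_power I r" by auto
    then have "\<mu> * m * ?s < r * a * c" using symbolic_power_subset_power[of m r] by force
    then have "real (\<mu> * m * ?s) < real (r * a * c)" by (simp only: of_nat_less_iff)
    then have "real m / real r \<le> ?\<rho>" using t(3) pos by (simp add: field_simps)
    then show "t \<le> ereal ?\<rho>" using t(1) by simp
  qed
  moreover have "ereal ?\<rho> \<le> Sup ?A"
  proof (rule LIMSEQ_le_const2)
    let ?x = "\<lambda>N. real a * real c / (real \<mu> * real ?s + 1 / real N)"
    have "?x \<longlonglongrightarrow> real a * real c / (real \<mu> * real ?s + 0)"
      using pos by (intro tendsto_divide tendsto_add tendsto_const lim_const_over_n) auto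
    then show "(\<lambda>N. ereal (?x N)) \<longlonglongrightarrow> ereal ?\<rho>" by simp
    show "\<exists>M. \<forall>N\<ge>M. ereal (?x N) \<le> Sup ?A"
    proof (intro exI[of _ 1] allI impI)
      fix N :: nat assume N: "N \<ge> 1"
      \<comment> \<open>These values make \<mu> m = c j exact, so the power lies in the symbolic
        power. Its degree is d a (r - 1), and the final + 1 in r pushes it just below I^r; as N
        grows, m / r tends to the claimed value.\<close>
      let ?m = "c * a * N" and ?r = "?s * \<mu> * N + 1" and ?j = "\<mu> * a * N"
      have j: "?j > 0" using N \<mu> a_pos by simp
      have mem: "mon (\<lambda>_. ?j) \<in> symbolic_power I ?m"
        by (rule product_power_in_symbolic_power) (simp add: mult_ac)
      have "mon (\<lambda>_. ?j) \<notin> ideal_power I ?r"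
      proof
        assume "mon (\<lambda>_. ?j) \<in> ideal_power I ?r"
        then have "d * (?r * a) \<le> d * (?s * ?j)"
          using degree_ge_if_mem_I_power[OF _ mon_nonzero] form_product_power[OF j]
          by (simp only: form_of_degree_def)
        then have "?r * a \<le> ?s * ?j" using d_pos by simp
        then show False using a_pos by (simp add: algebra_simps)
      qed
      then have "\<not> symbolic_power I ?m \<subseteq> ideal_power I ?r" using mem by blast
      moreover have "?m > 0" "?r > 0" using N c a_pos by simp_all
      ultimately have "ereal (real ?m / real ?r) \<in> ?A"
        by (intro CollectI exI[of _ ?m] exI[of _ ?r] conjI refl)
      then have "ereal (real ?m / real ?r) \<le> Sup ?A" by (rule Sup_upper)
      moreover have "?x N = real ?m / real ?r"
      proof -
        have "?x N = real a * real c * real N / ((real \<mu> * real ?s + 1 / real N) * real N)"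
          using N by (intro mult_divide_mult_cancel_right[symmetric]) simp
        also have "(real \<mu> * real ?s + 1 / real N) * real N = real ?r"
          using N by (simp add: distrib_right)
        also have "real a * real c * real N = real ?m" by (simp add: mult_ac)
        finally show ?thesis .
      qed
      ultimately show "ereal (?x N) \<le> Sup ?A" by simp
    qed
  qed
  ultimately show ?thesis unfolding resurgence_def by (rule antisym)
qed

end

theorem theorem5p4:
  fixes a b n s d :: nat
    and c\<^sub>0 \<mu> :: int
    and f :: "nat \<Rightarrow> ('v::{finite,linorder}, 'k::field) mpolyn"
    and I :: "('v, 'k) mpolyn set"
  assumes "infinite (UNIV :: 'k set)"
    and "CARD('v) = n + 1"
    and "a > 0" "b > 0" "n > 0" "s > 0"
    and "s \<ge> n + 1"
    and "b * (s - n) + 1 \<le> a" "a \<le> s * b"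
    and "c\<^sub>0 = int s - \<lfloor>(real a - 1) / real b\<rfloor>"
    and "\<mu> = int a - int b * (int s - c\<^sub>0)"
    and "inj_on f {1..s}"
    and "generic_forms (f ` {1..s})"
    and "\<And>i. i \<in> {1..s} \<Longrightarrow> form_of_degree d (f i)"
    and "I = fold_power_ideal a b s f"
  shows "resurgence I = ereal (real (initial_degree I) / asymptotic_initial_degree I) \<and>
         real (initial_degree I) / asymptotic_initial_degree I
           = (real a * real_of_int c\<^sub>0) / (real_of_int \<mu> * real s)"
proof -
  \<comment> \<open>Dividing a - 1 instead of a puts the shifted remainder in the range from 1 to b,
    so that \<mu> is never 0.\<close>
  define q where "q = (a - 1) div b"
  define c where "c = s - q"
  define \<mu>' where "\<mu>' = (a - 1) mod b + 1"
  have aq: "a = b * q + \<mu>'"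
    using mult_div_mod_eq[of b "a - 1"] assms(3) by (simp add: q_def \<mu>'_def)
  \<comment> \<open>The two bounds on a are exactly what yields 1 \<le> c \<le> n.\<close>
  have "q < s" unfolding q_def using assms(3,4,9) by (simp add: div_less_iff_less_mult mult.commute)
  moreover have "s - n \<le> q" unfolding q_def
    using assms(4,8) by (simp add: less_eq_div_iff_mult_less_eq mult.commute)
  ultimately have c: "1 \<le> c" "c \<le> n" "s - c = q" "c \<le> s" using assms(7) by (auto simp: c_def)
  have "\<lfloor>(real a - 1) / real b\<rfloor> = int q"
    unfolding q_def using floor_divide_of_nat_eq[of "a - 1" b] assms(3) by simp
  then have c0: "c\<^sub>0 = int c" using assms(10) c by (simp add: c_def)
  have "int s - c\<^sub>0 = int q" using c unfolding c0 by linarith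
  then have \<mu>: "\<mu> = int \<mu>'" unfolding assms(11) using aq by simp
  interpret generic_family "{1..s}" f d
    by (rule generic_family_if_generic_forms) (use assms in auto)
  interpret F: fold_ideal "{1..s}" f d a b c \<mu>'
    by unfold_locales (use aq c assms(2,4,7) in \<open>auto simp: \<mu>'_def Suc_le_eq\<close>)
  have I: "I = F.I"
    unfolding assms(15) fold_power_ideal_def F.I_def monomial_ideal_def monomial_def
      ideal_gen_eq_span ..
  have pos: "real d > 0" "real c > 0" "real \<mu>' > 0" "real s > 0"
    using d_pos c assms(6) by (auto simp: \<mu>'_def)
  have "real (initial_degree I) / asymptotic_initial_degree I = real a * real c / (real \<mu>' * real s)"
    unfolding I F.initial_degree_I F.asymptotic_initial_degree_I using pos by (simp add: field_simps)
  then show ?thesis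
    using F.resurgence_I unfolding I c0 \<mu> by simp
qed

end
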